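(* Let $G(t)\subset\mathbb{R}^2$, $t\ge 0$, be the set $$G(t)=\Phi_t^-(G_0^-)\cup\Phi_t^+(G_0^+(t))\cup\Psi_t(G_0^\times(t))\cup P_t^+\cup P_t^-$$ and let $t_*>0$ be the number, both as defined in the context. Then the following assertions hold. 1. For $0<t<t_*$, the set $G(t)$ has one connected component with nonempty interior. 2. For $0<t\le t_*$, the lower boundary of the part of $G(t)$ with $x_1\ge0$ is $x_2=\frac{x_1^2}{2}$, $0\le x_1\le t$. For $t>t_*$, only the truncated parabolic segment $\{(r,\tfrac12r^2):t-t_*\le r\le t\}$ bounds the right two-dimensional component. 3. For every $0<t<t_*$, the lower-phase part $G^-(t):=G(t)\cap\{x_2<0\}$ has a cusp at the origin. More precisely, near the origin its boundary contains the two tangentially meeting arcs $\{(x_1,0):-\varepsilon<x_1<0\}$ and $\{(x_1,-\tfrac12x_1^2):-\varepsilon<x_1<0\}$ for sufficiently small $\varepsilon>0$. 4. At $t=t_*$, the boundary of $G(t)$ develops a cusp at the origin. 5. For $t>t_*$, the interior of $G(t)$ has two connected components, denoted by $G_+(t)$ and $G_-(t)$. The full attainable set is obtained from the closures of these components together with the one-dimensional connector $P_t^*:=\{(\pm r,\pm\tfrac12r^2):0\le r\le t-t_*\}$; in other words, $G(t)=\overline{G_+(t)}\cup\overline{G_-(t)}\cup P_t^*$. 6. The two-dimensional Lebesgue measure of the interior of $G(t)$ is independent of $t$.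
   Context: Initial set: $G_0=\{(a,b)\in\mathbb{R}^2:(a+\tfrac12)^2+b^2\le\tfrac14\}$. Origin of $G(t)$: it is the attainable set at time $t$ from $G_0$, i.e. the set of all $x(t)$ with $x(\cdot)$ a strong (absolutely continuous) solution of the differential inclusion $\dot x_1(t)\in\mathrm{Sgn}(x_2(t))$, $\dot x_2(t)=x_1(t)$ with $x(0)\in G_0$, where $\mathrm{Sgn}(r)=\{-1\}$ for $r<0$, $\mathrm{Sgn}(0)=[-1,1]$, $\mathrm{Sgn}(r)=\{1\}$ for $r>0$. In the claim $G(t)$ is given by the displayed union, with: - $\Phi_t^-(a,b)=(a-t,\ b+ta-\tfrac12t^2)$ and $\Phi_t^+(a,b)=(a+t,\ b+ta+\tfrac12t^2)$. - $\tau(a,b)=-a-\sqrt{a^2-2b}$ (the first time a trajectory started at $(a,b)$ with $b>0$ crosses $x_2=0$), and $$\Psi_t(a,b)=\Bigl(a-t+2\tau(a,b),\ (a+\tau(a,b))(t-\tau(a,b))-\tfrac12(t-\tau(a,b))^2\Bigr).$$ - $P_t^\pm=\{(\pm r,\pm\tfrac12r^2):0\le r\le t\}$. - $m_t(a)=-at-\tfrac{t^2}{2}$ for $a\le-t$, and $m_t(a)=\tfrac{a^2}{2}$ for $-t\le a\le0$. - $G_0^-=\{(a,b)\in G_0:b\le0\}$, $G_0^+(t)=\{(a,b)\in G_0:b>0,\ b\ge m_t(a)\}$, $G_0^\times(t)=\{(a,b)\in G_0:b>0,\ b<m_t(a)\}$. - $t_*:=-a_0$, where $a_0\in(-1,0)$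 is the unique real root of $a^3+4a+4=0$ (so $a_0\approx-0.8477$). In $P_t^\pm$ and $P_t^*$ the two signs in a pair are taken equal (both $+$ or both $-$); $P_t^*$ comprises both sign choices. A cusp at a boundary point means that boundary pieces meet there with a common tangent line and zero opening angle, so that no uniform interior cone can be placed there and the boundary is not Lipschitz at that point. *)

theory Defs
  imports "HOL-Analysis.Analysis"
begin

definition G0 :: "(real \<times> real) set" where
  "G0 = {(a, b). (a + 1/2)\<^sup>2 + b\<^sup>2 \<le> 1/4}"

definition Phi_minus :: "real \<Rightarrow> real \<times> real \<Rightarrow> real \<times> real" where
  "Phi_minus t = (\<lambda>(a, b). (a - t, b + t * a - t\<^sup>2 / 2))"

definition Phi_plus :: "real \<Rightarrow> real \<times> real \<Rightarrow> real \<times> real" where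
  "Phi_plus t = (\<lambda>(a, b). (a + t, b + t * a + t\<^sup>2 / 2))"

definition cross_time :: "real \<Rightarrow> real \<Rightarrow> real" where
  "cross_time a b = - a - sqrt (a\<^sup>2 - 2 * b)"

definition Psi :: "real \<Rightarrow> real \<times> real \<Rightarrow> real \<times> real" where
  "Psi t = (\<lambda>(a, b).
     (a - t + 2 * cross_time a b,
      (a + cross_time a b) * (t - cross_time a b) - (t - cross_time a b)\<^sup>2 / 2))"

definition P_plus :: "real \<Rightarrow> (real \<times> real) set" where
  "P_plus t = {(r, r\<^sup>2 / 2) | r. 0 \<le> r \<and> r \<le> t}"

definition P_minus :: "real \<Rightarrow> (real \<times> real) set" where
  "P_minus t = {(- r, - (r\<^sup>2 / 2)) | r. 0 \<le> r \<and> r \<le> t}"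

text \<open>The threshold is only used for \<open>a \<le> 0\<close>, which holds on the initial disc.\<close>

definition threshold :: "real \<Rightarrow> real \<Rightarrow> real" where
  "threshold t a = (if a \<le> - t then - a * t - t\<^sup>2 / 2 else a\<^sup>2 / 2)"

definition G0_minus :: "(real \<times> real) set" where
  "G0_minus = {(a, b). (a, b) \<in> G0 \<and> b \<le> 0}"

definition G0_plus :: "real \<Rightarrow> (real \<times> real) set" where
  "G0_plus t = {(a, b). (a, b) \<in> G0 \<and> b > 0 \<and> b \<ge> threshold t a}"

definition G0_cross :: "real \<Rightarrow> (real \<times> real) set" where
  "G0_cross t = {(a, b). (a, b) \<in> G0 \<and> b > 0 \<and> b < threshold t a}"

definition G :: "real \<Rightarrow> (real \<times> real) set" where
  "G t = Phi_minus t ` G0_minus \<union> Phi_plus t ` G0_plus t \<union> Psi t ` G0_cross t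
         \<union> P_plus t \<union> P_minus t"

definition G_lower_phase :: "real \<Rightarrow> (real \<times> real) set" where
  "G_lower_phase t = G t \<inter> {x. snd x < 0}"

definition a_zero :: real where
  "a_zero = (THE a. a ^ 3 + 4 * a + 4 = 0)"

definition t_star :: real where
  "t_star = - a_zero"

lemma ex1_root: "\<exists>!a::real. a ^ 3 + 4 * a + 4 = 0"
  and a_zero_root: "a_zero ^ 3 + 4 * a_zero + 4 = 0"
  and a_zero_bounds: "-1 < a_zero" "a_zero < 0"
proof -
  have mono: "x ^ 3 + 4 * x + 4 < y ^ 3 + 4 * y + 4" if "x < y" for x y :: real
    using power_mono_odd[of 3 x y] that by simp
  have "\<exists>x::real. -1 \<le> x \<and> x \<le> 0 \<and> x ^ 3 + 4 * x + 4 = 0"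
    by (rule IVT') (auto intro!: continuous_intros)
  then obtain x :: real where x: "x ^ 3 + 4 * x + 4 = 0" by blast
  show ex1: "\<exists>!a::real. a ^ 3 + 4 * a + 4 = 0"
    using x mono by (metis less_irrefl linorder_neqE_linordered_idom)
  show root: "a_zero ^ 3 + 4 * a_zero + 4 = 0"
    unfolding a_zero_def by (rule theI'[OF ex1])
  show "-1 < a_zero"
  proof (rule ccontr)
    assume "\<not> -1 < a_zero"
    then have "a_zero \<le> -1" by simp
    with power_mono_odd[of 3 a_zero "-1"] show False using root by simp
  qed
  show "a_zero < 0"
  proof (rule ccontr)
    assume "\<not> a_zero < 0"
    then have "0 \<le> a_zero ^ 3" and "0 \<le> a_zero"
      by simp_all
    then show False using root by linarith
  qed
qed

definition lower_boundary :: "(real \<times> real) set \<Rightarrow> (real \<times> real) set" where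
  "lower_boundary S = {(x, y). (x, y) \<in> S \<and> (\<forall>y'. (x, y') \<in> S \<longrightarrow> y \<le> y')}"

text \<open>The point with coordinates \<open>(x, y)\<close> in the orthonormal frame at \<open>p\<close> spanned by the
  unit vector \<open>v\<close> and its rotation by a quarter turn.\<close>

definition frame_pt :: "real \<times> real \<Rightarrow> real \<times> real \<Rightarrow> real \<Rightarrow> real \<Rightarrow> real \<times> real" where
  "frame_pt p v x y = p + x *\<^sub>R v + y *\<^sub>R (- snd v, fst v)"

text \<open>Two boundary pieces of \<open>S\<close> that issue from \<open>p\<close> on the same side, written as graphs over
  the common tangent ray in direction \<open>v\<close>. Both are tangent to that ray at \<open>p\<close>, and the sector
  between them, which has opening angle zero, belongs to \<open>S\<close>.\<close>

definition cusp_pieces ::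
  "(real \<times> real) set \<Rightarrow> real \<times> real \<Rightarrow> real \<times> real \<Rightarrow> (real \<Rightarrow> real) \<Rightarrow> (real \<Rightarrow> real) \<Rightarrow> real \<Rightarrow> bool"
  where
  "cusp_pieces S p v f g \<delta> \<longleftrightarrow>
     norm v = 1 \<and> 0 < \<delta> \<and>
     continuous_on {0..<\<delta>} f \<and> continuous_on {0..<\<delta>} g \<and>
     f 0 = 0 \<and> g 0 = 0 \<and>
     ((\<lambda>x. f x / x) \<longlongrightarrow> 0) (at_right 0) \<and> ((\<lambda>x. g x / x) \<longlongrightarrow> 0) (at_right 0) \<and>
     (\<forall>x. 0 < x \<and> x < \<delta> \<longrightarrow> f x < g x) \<and>
     (\<forall>x. 0 \<le> x \<and> x < \<delta> \<longrightarrow>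
        frame_pt p v x (f x) \<in> frontier S \<and> frame_pt p v x (g x) \<in> frontier S) \<and>
     (\<forall>x y. 0 < x \<and> x < \<delta> \<and> f x < y \<and> y < g x \<longrightarrow> frame_pt p v x y \<in> S)"

definition open_cone :: "real \<times> real \<Rightarrow> real \<times> real \<Rightarrow> real \<Rightarrow> real \<Rightarrow> (real \<times> real) set" where
  "open_cone q w \<theta> h = {q + z | z. 0 < norm z \<and> norm z < h \<and> cos \<theta> * norm z < z \<bullet> w}"

text \<open>The height and the half-angle are uniform near \<open>p\<close>; the axis may depend on the vertex.\<close>

definition uniform_interior_cone_at :: "(real \<times> real) set \<Rightarrow> real \<times> real \<Rightarrow> bool" where
  "uniform_interior_cone_at S p \<longleftrightarrow>
     (\<exists>r>0. \<exists>h>0. \<exists>\<theta>. 0 < \<theta> \<and> \<theta> < pi / 2 \<and>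
        (\<forall>q \<in> interior S \<inter> ball p r. \<exists>w. norm w = 1 \<and> open_cone q w \<theta> h \<subseteq> interior S))"

definition lipschitz_boundary_at :: "(real \<times> real) set \<Rightarrow> real \<times> real \<Rightarrow> bool" where
  "lipschitz_boundary_at S p \<longleftrightarrow>
     (\<exists>v r h L \<phi>. norm v = 1 \<and> 0 < r \<and> 0 < h \<and> L-lipschitz_on {-r<..<r} \<phi> \<and>
        (\<forall>x y. \<bar>x\<bar> < r \<and> \<bar>y\<bar> < h \<longrightarrow>
           (frame_pt p v x y \<in> frontier S \<longleftrightarrow> y = \<phi> x) \<and>
           (frame_pt p v x y \<in> interior S \<longleftrightarrow> \<phi> x < y)))"

definition cusp_at :: "(real \<times> real) set \<Rightarrow> real \<times> real \<Rightarrow> bool" where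
  "cusp_at S p \<longleftrightarrow>
     (\<exists>v f g \<delta>. cusp_pieces S p v f g \<delta>) \<and>
     \<not> uniform_interior_cone_at S p \<and> \<not> lipschitz_boundary_at S p"

end

theory Submission
  imports Defs
begin

text \<open>The threshold curve cuts the disc into a convex cap, on which the flow up to time \<open>t\<close> is the
  affine map \<open>Phi_plus t\<close>, and its complement, on which it is a continuous injective map glued from
  \<open>Phi_minus t\<close> and \<open>Psi t\<close>. Both maps are compositions of shears and reflections, so they preserve
  area, and the images of the two open pieces are open, connected and dense in the two-dimensional
  part of \<open>G t\<close>. The images touch along a segment of the \<open>x\<close>-axis ending at the origin exactly when
  the point \<open>(- t, t\<^sup>2 / 2)\<close>, which reaches the origin at time \<open>t\<close>, is interior to the disc, that
  is for \<open>t < t_star\<close>; for \<open>t > t_star\<close> they lie in opposite half planes. A Lipschitz boundary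
  yields uniform interior cones, and these cannot fit into a region of quadratically small
  height.\<close>

text \<open>The interior of \<open>G t\<close> is never determined. It is only sandwiched: it
  contains the open sets \<open>G_up t\<close> and \<open>G_down t\<close> and lies in the union of
  their closures. Connectedness, closures and area are insensitive to what lies in between, so this
  suffices. The pieces in the definition of \<open>G\<close> are half-open, which is awkward for
  closures of images; they are replaced by the compact sets \<open>cap t\<close> and
  \<open>hypo t\<close>, at the price of checking that the added boundary points already belong to
  \<open>G t\<close>. The geometry rests on two conserved quantities:
  \<open>b - a\<^sup>2 / 2\<close> along trajectories above the axis and
  \<open>b + a\<^sup>2 / 2\<close> below it. Trajectories coming from above reach the origin only
  along the parabola \<open>b = a\<^sup>2 / 2\<close>, and from there they may continue into either
  arc \<open>P_plus\<close> or \<open>P_minus\<close>. Hence these arcs bound \<open>G t\<close>,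
  and the splitting is decided by how much of that parabola lies in the disc.\<close>

lemma mem_G0: "(a, b) \<in> G0 \<longleftrightarrow> a\<^sup>2 + a + b\<^sup>2 \<le> 0"
proof -
  have "(a + 1/2)\<^sup>2 + b\<^sup>2 = a\<^sup>2 + a + b\<^sup>2 + 1/4"
    by (simp add: power2_eq_square field_simps)
  then show ?thesis by (auto simp: G0_def)
qed

lemma G0_fst_bounds:
  assumes "(a, b) \<in> G0" shows "- 1 \<le> a" "a \<le> 0"
proof -
  have *: "a * (a + 1) \<le> 0"
    using assms zero_le_power2[of b] unfolding mem_G0
    by (simp add: power2_eq_square algebra_simps del: zero_le_square)
  show "a \<le> 0"
    using * by (smt (verit) mult_pos_pos)
  show "- 1 \<le> a"
    using * by (smt (verit) mult_neg_neg)
qed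

text \<open>Identifies the disc with a metric ball of the product space, which supplies compactness,
  convexity and the interior.\<close>

lemma G0_eq_cball: "G0 = cball (- 1/2, 0) (1/2)"
proof -
  have "((a + 1/2)\<^sup>2 + b\<^sup>2 \<le> 1/4) \<longleftrightarrow> sqrt ((- 1/2 - a)\<^sup>2 + (0 - b)\<^sup>2) \<le> 1/2" for a b :: real
  proof -
    have "(sqrt ((- 1/2 - a)\<^sup>2 + (0 - b)\<^sup>2) \<le> 1/2) \<longleftrightarrow> (- 1/2 - a)\<^sup>2 + (0 - b)\<^sup>2 \<le> (1/2)\<^sup>2"
      using real_sqrt_le_iff[of "(- 1/2 - a)\<^sup>2 + (0 - b)\<^sup>2" "(1/2)\<^sup>2"] by (simp only: real_sqrt_abs) simp
    then show ?thesis by (simp add: power2_eq_square algebra_simps)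
  qed
  then show ?thesis
    by (auto simp: G0_def dist_Pair_Pair dist_real_def)
qed

lemma compact_G0: "compact G0" and convex_G0: "convex G0"
  by (simp_all add: G0_eq_cball)

section \<open>The threshold curve\<close>

text \<open>Completing the square merges both branches into one formula, from which continuity and
  the bound \<open>a\<^sup>2 / 2\<close> are immediate.\<close>

lemma threshold_alt: "threshold t a = a\<^sup>2 / 2 - (min 0 (a + t))\<^sup>2 / 2"
proof -
  have "- a * t - t\<^sup>2 / 2 = a\<^sup>2 / 2 - (a + t)\<^sup>2 / 2"
    by (simp add: power2_eq_square field_simps)
  then show ?thesis by (auto simp: threshold_def min_def)
qed

lemma continuous_on_threshold [continuous_intros]:
  "continuous_on A f \<Longrightarrow> continuous_on A (\<lambda>x. threshold t (f x))"
  unfolding threshold_alt by (intro continuous_intros) auto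

lemma threshold_le: "threshold t a \<le> a\<^sup>2 / 2"
  by (simp add: threshold_alt)

lemma threshold_right: "- t \<le> a \<Longrightarrow> threshold t a = a\<^sup>2 / 2"
  by (simp add: threshold_alt)

lemma threshold_left: "a \<le> - t \<Longrightarrow> threshold t a = - a * t - t\<^sup>2 / 2"
  by (simp add: threshold_def)

lemma threshold_pos:
  assumes "0 < t" "a < 0" shows "0 < threshold t a"
proof (cases "a \<le> - t")
  case True
  then have "t * t \<le> - a * t" using assms by (intro mult_right_mono) auto
  moreover have "0 < t * t" using assms by simp
  ultimately show ?thesis using True by (simp add: threshold_def power2_eq_square)
qed (use assms in \<open>simp add: threshold_def\<close>)

lemma threshold_nonneg: "0 < t \<Longrightarrow> a \<le> 0 \<Longrightarrow> 0 \<le> threshold t a"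
  using threshold_pos[of t a] by (cases "a = 0") (auto simp: threshold_def)

text \<open>The threshold curve is the envelope of tangents to a parabola, hence convex.\<close>

lemma threshold_le_iff: "threshold t a \<le> b \<longleftrightarrow> (\<forall>c\<ge>- t. c * a - c\<^sup>2 / 2 \<le> b)"
proof
  have "c * a - c\<^sup>2 / 2 \<le> threshold t a" if "c \<ge> - t" for c
  proof (cases "a \<le> - t")
    case True
    have "0 \<le> (c + t) * (c - t - 2 * a)"
      using that True by (intro mult_nonneg_nonneg) auto
    then show ?thesis using True
      by (simp add: threshold_def power2_eq_square algebra_simps)
  next
    case False
    have "0 \<le> (a - c)\<^sup>2" by simp
    then show ?thesis using False
      by (simp add: threshold_def power2_eq_square algebra_simps)
  qed
  then show "threshold t a \<le> b \<Longrightarrow> \<forall>c\<ge>- t. c * a - c\<^sup>2 / 2 \<le> b"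
    by (meson order_trans)
next
  assume *: "\<forall>c\<ge>- t. c * a - c\<^sup>2 / 2 \<le> b"
  \<comment> \<open>As a function of \<open>c\<close>, the expression
    \<open>c * a - c\<^sup>2 / 2\<close> peaks at \<open>c = a\<close>; restricted to
    \<open>c \<ge> - t\<close> its maximum is attained at \<open>max a (- t)\<close> and equals the
    threshold.\<close>
  show "threshold t a \<le> b"
    using *[rule_format, of "max a (- t)"]
    by (auto simp: threshold_def max_def power2_eq_square field_simps split: if_splits)
qed

text \<open>The closed counterpart of \<open>G0_plus t\<close>: without the condition
  \<open>b > 0\<close> the set is compact and convex, and for \<open>0 < t\<close> only the origin
  is added.\<close>

definition cap :: "real \<Rightarrow> (real \<times> real) set" where
  "cap t = G0 \<inter> {p. threshold t (fst p) \<le> snd p}"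

text \<open>The overlap with \<open>cap t\<close> along the threshold is deliberate. For
  \<open>0 < t\<close> the two flows agree on its straight part, and on its parabolic part they land
  on the two arcs, so no point outside \<open>G t\<close> is produced.\<close>

definition hypo :: "real \<Rightarrow> (real \<times> real) set" where
  "hypo t = G0 \<inter> {p. snd p \<le> threshold t (fst p)}"

definition open_hypo :: "real \<Rightarrow> (real \<times> real) set" where
  "open_hypo t = interior G0 \<inter> {p. snd p < threshold t (fst p)}"

text \<open>Each line of the envelope contributes a half plane, and the region above the threshold
  is their intersection.\<close>

lemma convex_cap: "convex (cap t)"
proof -
  have "{p. threshold t (fst p) \<le> snd p} = (\<Inter>c\<in>{- t..}. {p :: real \<times> real. (c, - 1) \<bullet> p \<le> c\<^sup>2 / 2})"
    by (force simp: threshold_le_iff inner_prod_def algebra_simps)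
  moreover have "convex (\<Inter>c\<in>{- t..}. {p :: real \<times> real. (c, - 1) \<bullet> p \<le> c\<^sup>2 / 2})"
    by (intro convex_INT convex_halfspace_le)
  ultimately show ?thesis
    unfolding cap_def by (metis convex_Int convex_G0)
qed

lemma compact_cap: "compact (cap t)" and compact_hypo: "compact (hypo t)"
  unfolding cap_def hypo_def
  by (intro compact_Int_closed compact_G0 closed_Collect_le continuous_intros)+

lemma open_open_hypo: "open (open_hypo t)"
  unfolding open_hypo_def by (intro open_Int open_interior open_Collect_less continuous_intros)

lemma interior_G0_I:
  assumes "a\<^sup>2 + a + b\<^sup>2 < 0" shows "(a, b) \<in> interior G0"
proof -
  have "open {p :: real \<times> real. (fst p)\<^sup>2 + fst p + (snd p)\<^sup>2 < 0}"
    by (intro open_Collect_less continuous_intros)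
  then show ?thesis
    by (rule interiorI) (use assms in \<open>auto simp: mem_G0\<close>)
qed

lemma interior_G0_iff: "(a, b) \<in> interior G0 \<longleftrightarrow> a\<^sup>2 + a + b\<^sup>2 < 0"
proof
  assume "(a, b) \<in> interior G0"
  then have "sqrt ((- 1/2 - a)\<^sup>2 + (0 - b)\<^sup>2) < sqrt ((1/2)\<^sup>2)"
    unfolding real_sqrt_abs
    by (simp add: G0_eq_cball interior_cball dist_Pair_Pair dist_real_def)
  then have "(- 1/2 - a)\<^sup>2 + (0 - b)\<^sup>2 < (1/2)\<^sup>2"
    by (simp only: real_sqrt_less_iff)
  then show "a\<^sup>2 + a + b\<^sup>2 < 0"
    by (simp add: power2_eq_square field_simps)
qed (rule interior_G0_I)

lemma interior_cap_nonempty: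
  assumes "0 < t" shows "interior (cap t) \<noteq> {}"
proof -
  let ?U = "interior G0 \<inter> {p. threshold t (fst p) < snd p}"
  \<comment> \<open>Since \<open>c \<le> t\<close>, the threshold at \<open>- c\<close> is
    \<open>c\<^sup>2 / 2\<close>, which is below \<open>c / 2\<close>; and
    \<open>(- c, c / 2)\<close> is interior to the disc because \<open>c < 4/5\<close>.\<close>
  define c where "c = min t (1/2)"
  have c: "0 < c" "c \<le> t" "c \<le> 1/2" using assms by (auto simp: c_def)
  have "c * c \<le> c * (1/2)" using c by (intro mult_left_mono) auto
  then have "(- c, c / 2) \<in> ?U"
    using c by (simp add: interior_G0_iff threshold_right power2_eq_square)
  moreover have "open ?U"
    by (intro open_Int open_interior open_Collect_less continuous_intros)
  moreover have "?U \<subseteq> cap t"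
    using interior_subset by (auto simp: cap_def)
  ultimately show ?thesis
    using interior_maximal by blast
qed

lemma closure_interior_cap: "0 < t \<Longrightarrow> closure (interior (cap t)) = cap t"
  using convex_closure_interior[OF convex_cap interior_cap_nonempty] compact_cap
  by (simp add: closure_closed compact_imp_closed)

lemma axis_in_open_hypo:
  assumes "0 < t" "- 1 < a" "a < 0" shows "(a, 0) \<in> open_hypo t"
proof -
  have "a * (a + 1) < 0" using assms by (simp add: mult_neg_pos)
  then show ?thesis
    using assms threshold_pos[of t a]
    by (simp add: open_hypo_def interior_G0_iff power2_eq_square algebra_simps)
qed

lemma open_hypo_fst:
  assumes "(a, b) \<in> open_hypo t" shows "- 1 < a" "a < 0"
proof -
  have "a * (a + 1) < 0"
    using assms zero_le_power2[of b]
    by (simp add: open_hypo_def interior_G0_iff power2_eq_square algebra_simps del: zero_le_square)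
  then show "- 1 < a" "a < 0" by (auto simp: mult_less_0_iff)
qed

text \<open>What remains below a convex curve need not be convex, so the set is built as a comb:
  every vertical fibre is convex and meets the axis segment \<open>?J\<close>, which serves as the
  spine.\<close>

lemma connected_open_hypo:
  assumes "0 < t" shows "connected (open_hypo t)"
proof -
  let ?J = "{- 1<..<0::real} \<times> {0::real}"
  let ?V = "\<lambda>p::real \<times> real. open_hypo t \<inter> ({fst p} \<times> UNIV)"
  have J: "?J \<subseteq> open_hypo t"
    using assms axis_in_open_hypo by auto
  have fib: "connected (?V p)" for p
  proof -
    have "?V p = interior G0 \<inter> {q. fst q = fst p} \<inter> {q. snd q < threshold t (fst p)}"
      by (auto simp: open_hypo_def)
    moreover have "convex (interior G0 \<inter> {q. fst q = fst p} \<inter> {q. snd q < threshold t (fst p)})"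
      using convex_hyperplane[of "(1, 0) :: real \<times> real" "fst p"]
        convex_halfspace_lt[of "(0, 1) :: real \<times> real" "threshold t (fst p)"]
      by (intro convex_Int convex_interior convex_G0) (simp_all add: inner_prod_def)
    ultimately show ?thesis by (simp add: convex_connected)
  qed
  have "connected (\<Union>p\<in>open_hypo t. ?J \<union> ?V p)"
  proof (rule connected_Union)
    fix S assume "S \<in> (\<lambda>p. ?J \<union> ?V p) ` open_hypo t"
    then obtain p where p: "p \<in> open_hypo t" and S: "S = ?J \<union> ?V p" by blast
    show "connected S"
      unfolding S
    proof (rule connected_Un)
      show "connected ?J" by (simp add: connected_Times)
      have "(fst p, 0) \<in> ?J" using p open_hypo_fst[of "fst p" "snd p" t] by auto
      then have "(fst p, 0) \<in> ?J \<inter> ?V p" using J by auto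
      then show "?J \<inter> ?V p \<noteq> {}" by blast
    qed (rule fib)
  next
    have "(- 1/2, 0) \<in> (\<Inter>p\<in>open_hypo t. ?J \<union> ?V p)" by auto
    then show "(\<Inter>p\<in>open_hypo t. ?J \<union> ?V p) \<noteq> {}" by blast
  qed
  moreover have "(\<Union>p\<in>open_hypo t. ?J \<union> ?V p) = open_hypo t"
    using J by (fastforce simp: mem_Times_iff)
  ultimately show ?thesis by simp
qed

text \<open>Shrinking a point vertically towards the axis, \<open>(a, l * b)\<close> with
  \<open>0 < l < 1\<close>, makes both defining inequalities strict when \<open>- 1 < a < 0\<close>.
  At \<open>a = - 1\<close> and \<open>a = 0\<close> the fibre is a single point, which is
  approached along the axis instead.\<close>

lemma closure_open_hypo:
  assumes "0 < t" shows "closure (open_hypo t) = hypo t"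
proof
  have "open_hypo t \<subseteq> hypo t"
    using interior_subset by (auto simp: open_hypo_def hypo_def)
  then show "closure (open_hypo t) \<subseteq> hypo t"
    by (simp add: closure_minimal compact_hypo compact_imp_closed)
  show "hypo t \<subseteq> closure (open_hypo t)"
  proof clarify
    fix a b assume ab: "(a, b) \<in> hypo t"
    then have G: "a\<^sup>2 + a + b\<^sup>2 \<le> 0" and b: "b \<le> threshold t a"
      by (auto simp: hypo_def mem_G0)
    have a: "- 1 \<le> a" "a \<le> 0" using G0_fst_bounds[of a b] ab by (auto simp: hypo_def)
    show "(a, b) \<in> closure (open_hypo t)"
    proof (cases "- 1 < a \<and> a < 0")
      case True
      have "((\<lambda>l. (a, l * b)) \<longlongrightarrow> (a, 1 * b)) (at_left 1)"
        by (intro tendsto_intros)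
      moreover have "\<forall>\<^sub>F l in at_left 1. (a, l * b) \<in> open_hypo t"
        using eventually_at_left_real[of 0 "1::real", OF zero_less_one]
      proof eventually_elim
        case (elim l)
        have neg: "a\<^sup>2 + a < 0"
          using True mult_neg_pos[of a "a + 1"] by (simp add: power2_eq_square algebra_simps)
        \<comment> \<open>The disc polynomial at \<open>(a, l * b)\<close> is the sum of this
          nonpositive term and the negative term
          \<open>(1 - l\<^sup>2) * (a\<^sup>2 + a)\<close>.\<close>
        have "l\<^sup>2 * (a\<^sup>2 + a + b\<^sup>2) \<le> 0"
          using G by (simp add: mult_nonneg_nonpos)
        moreover have "(1 - l\<^sup>2) * (a\<^sup>2 + a) < 0"
          using neg elim by (intro mult_pos_neg) (auto simp: power_less_one_iff)
        ultimately have "a\<^sup>2 + a + (l * b)\<^sup>2 < 0"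
          by (simp add: algebra_simps power_mult_distrib)
        moreover have "l * b < threshold t a"
        proof (cases "b \<le> 0")
          case True
          then have "l * b \<le> 0" using elim by (simp add: mult_nonneg_nonpos)
          then show ?thesis using threshold_pos[of t a] assms \<open>- 1 < a \<and> a < 0\<close> by simp
        next
          case False
          then have "l * b < 1 * b" using elim by (intro mult_strict_right_mono) auto
          then show ?thesis using b by simp
        qed
        ultimately show ?case by (simp add: open_hypo_def interior_G0_iff)
      qed
      ultimately have "(a, 1 * b) \<in> closure (open_hypo t)"
        by (intro Lim_in_closed_set[of "closure (open_hypo t)" _ "at_left 1"])
          (auto elim!: eventually_mono simp: closure_subset[THEN subsetD])
      then show ?thesis by simp
    next
      case False
      then have a': "a = - 1 \<or> a = 0" using a by auto
      then have b0: "b = 0" using G by auto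
      have "((\<lambda>l. (l * a + (1 - l) * (- 1/2), 0)) \<longlongrightarrow> (1 * a + (1 - 1) * (- 1/2), 0::real)) (at_left 1)"
        by (intro tendsto_intros)
      moreover have "\<forall>\<^sub>F l in at_left 1. (l * a + (1 - l) * (- 1/2), 0) \<in> open_hypo t"
        using eventually_at_left_real[of 0 "1::real", OF zero_less_one]
        by eventually_elim (use assms a' in \<open>auto intro!: axis_in_open_hypo simp: field_simps\<close>)
      ultimately have "(1 * a + (1 - 1) * (- 1/2), 0) \<in> closure (open_hypo t)"
        by (intro Lim_in_closed_set[of "closure (open_hypo t)" _ "at_left 1"])
          (auto elim!: eventually_mono simp: closure_subset[THEN subsetD])
      then show ?thesis using b0 by simp
    qed
  qed
qed

section \<open>The critical time\<close>

lemma t_star_root: "t_star ^ 3 + 4 * t_star - 4 = 0"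
  using a_zero_root by (simp add: t_star_def power3_eq_cube)

lemma cubic_strict_mono: "x < y \<Longrightarrow> x ^ 3 + 4 * x < y ^ 3 + 4 * (y::real)"
  using power_mono_odd[of 3 x y] by simp

lemma t_star_bounds: "1/2 < t_star" "t_star < 1"
proof -
  show "t_star < 1" using a_zero_bounds by (simp add: t_star_def)
  show "1/2 < t_star"
  proof (rule ccontr)
    assume "\<not> 1/2 < t_star"
    then have "t_star ^ 3 + 4 * t_star \<le> (1/2) ^ 3 + 4 * (1/2)"
      by (intro add_mono power_mono_odd) auto
    then show False using t_star_root by (simp add: power3_eq_cube)
  qed
qed

text \<open>The origin of the cubic: inserting a point of the parabola
  \<open>b = a\<^sup>2 / 2\<close> into the disc polynomial leaves, up to the factor
  \<open>c / 4\<close>, the cubic with root \<open>t_star\<close>. So the parabola leaves the disc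
  at \<open>- t_star\<close>.\<close>

lemma parabola_poly: "(- c)\<^sup>2 + (- c) + (c\<^sup>2 / 2)\<^sup>2 = c * (c ^ 3 + 4 * c - 4) / (4::real)"
  by (simp add: power2_eq_square power3_eq_cube field_simps)

lemma parabola_in_G0:
  assumes "0 \<le> c" "c \<le> t_star" shows "(- c, c\<^sup>2 / 2) \<in> G0"
proof -
  have "c ^ 3 + 4 * c - 4 \<le> 0"
    using cubic_strict_mono[of c t_star] t_star_root assms by (cases "c = t_star") auto
  then show ?thesis
    unfolding mem_G0 parabola_poly using assms by (simp add: mult_nonneg_nonpos)
qed

lemma parabola_in_interior_G0:
  assumes "0 < c" "c < t_star" shows "(- c, c\<^sup>2 / 2) \<in> interior G0"
proof -
  have "c ^ 3 + 4 * c - 4 < 0"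
    using cubic_strict_mono[of c t_star] t_star_root assms by auto
  then show ?thesis
    unfolding interior_G0_iff parabola_poly using assms by (simp add: mult_pos_neg)
qed

text \<open>The circle passes through \<open>(- t_star, t_star\<^sup>2 / 2)\<close>. Because
  \<open>t_star > 1/2\<close>, this point is on the left half of the disc, where the height of the
  circle decreases to the left.\<close>

lemma G0_height_left:
  assumes "(a, b) \<in> G0" "a < - t_star" shows "b < t_star\<^sup>2 / 2"
proof -
  have "(a + t_star) * (a + 1 - t_star) > 0"
    using assms t_star_bounds by (intro mult_neg_neg) auto
  then have "b\<^sup>2 < t_star - t_star\<^sup>2"
    using assms by (simp add: mem_G0 power2_eq_square algebra_simps)
  also have "\<dots> = (t_star\<^sup>2 / 2)\<^sup>2"
    using parabola_poly[of t_star] t_star_root by simp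
  finally show ?thesis
    by (rule power2_less_imp_less) simp
qed

text \<open>For \<open>t \<ge> t_star\<close> the line with \<open>c = - t_star\<close> takes part
  in the envelope. To the left of \<open>- t_star\<close> it is at least
  \<open>t_star\<^sup>2 / 2\<close> high, whereas the disc stays below that height.\<close>

lemma cap_fst_ge:
  assumes "t_star \<le> t" "(a, b) \<in> cap t" shows "- t_star \<le> a"
proof (rule ccontr)
  assume "\<not> - t_star \<le> a"
  then have a: "a < - t_star" by simp
  have b: "b < t_star\<^sup>2 / 2" using assms a by (intro G0_height_left) (auto simp: cap_def)
  have "threshold t a \<ge> (- t_star) * a - t_star\<^sup>2 / 2"
    using assms threshold_le_iff[of t a "threshold t a"] by (auto dest: spec[of _ "- t_star"])
  moreover have "t_star * (- t_star) \<ge> t_star * a"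
    using a t_star_bounds by (intro mult_left_mono) auto
  ultimately show False
    using b assms by (auto simp: cap_def power2_eq_square)
qed

section \<open>The flow maps\<close>

text \<open>A globally defined homeomorphism that agrees with \<open>Psi t\<close> where \<open>2 * b \<le> a\<^sup>2\<close>: it sends
  the arc \<open>b - a\<^sup>2 / 2 = c\<close> to the arc \<open>y + x\<^sup>2 / 2 = - c\<close>.\<close>

definition cross_map :: "real \<Rightarrow> real \<times> real \<Rightarrow> real \<times> real" where
  "cross_map t = (\<lambda>(a, b). let s = sqrt (a\<^sup>2 - 2 * b) in
     (- a - t - 2 * s, (a\<^sup>2 - 2 * b - (a + t + 2 * s)\<^sup>2) / 2))"

text \<open>This is \<open>cross_map t\<close> conjugated by the reflection \<open>(x, y)\<close> to
  \<open>(x, - y)\<close>, an instance of time reversal.\<close>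

definition cross_inv :: "real \<Rightarrow> real \<times> real \<Rightarrow> real \<times> real" where
  "cross_inv t = (\<lambda>(x, y). let s = sqrt (x\<^sup>2 + 2 * y) in
     (- x - t - 2 * s, ((x + t + 2 * s)\<^sup>2 - (x\<^sup>2 + 2 * y)) / 2))"

text \<open>One map for everything outside the cap: points with \<open>b \<le> 0\<close> follow
  \<open>Phi_minus\<close> at once, the others cross the axis first. The branches agree on the
  negative axis, so \<open>hypo t\<close> need not be cut there.\<close>

definition fall :: "real \<Rightarrow> real \<times> real \<Rightarrow> real \<times> real" where
  "fall t p = (if snd p \<le> 0 then Phi_minus t p else cross_map t p)"

text \<open>The identity is algebraic in the value of the square root, hence valid in the whole
  plane, also where the radicand is negative.\<close>

lemma cross_map_energy:
  assumes "cross_map t (a, b) = (x, y)" shows "x\<^sup>2 + 2 * y = a\<^sup>2 - 2 * b"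
proof -
  have "x = - (a + t + 2 * sqrt (a\<^sup>2 - 2 * b))"
    "2 * y = a\<^sup>2 - 2 * b - (a + t + 2 * sqrt (a\<^sup>2 - 2 * b))\<^sup>2"
    using assms by (auto simp: cross_map_def Let_def)
  then show ?thesis by (simp only: power2_minus)
qed

lemma cross_inv_energy:
  assumes "cross_inv t (x, y) = (a, b)" shows "a\<^sup>2 - 2 * b = x\<^sup>2 + 2 * y"
proof -
  have "a = - (x + t + 2 * sqrt (x\<^sup>2 + 2 * y))"
    "2 * b = (x + t + 2 * sqrt (x\<^sup>2 + 2 * y))\<^sup>2 - (x\<^sup>2 + 2 * y)"
    using assms by (auto simp: cross_inv_def Let_def)
  then show ?thesis by (simp only: power2_minus)
qed

text \<open>By conservation of the energy both maps take the same square root; the first coordinate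
  is then recovered by solving a linear equation.\<close>

lemma cross_inv_cross_map: "cross_inv t (cross_map t p) = p"
proof -
  obtain a b x y where p: "p = (a, b)" and xy: "cross_map t p = (x, y)" by (metis surj_pair)
  have e: "x\<^sup>2 + 2 * y = a\<^sup>2 - 2 * b" using cross_map_energy xy p by blast
  have "x = - a - t - 2 * sqrt (a\<^sup>2 - 2 * b)"
    using xy by (auto simp: p cross_map_def Let_def)
  then have a: "- x - t - 2 * sqrt (a\<^sup>2 - 2 * b) = a" "x + t + 2 * sqrt (a\<^sup>2 - 2 * b) = - a"
    by simp_all
  show ?thesis
    unfolding p xy[unfolded p] by (simp add: cross_inv_def Let_def e a)
qed

lemma cross_map_cross_inv: "cross_map t (cross_inv t p) = p"
proof -
  obtain a b x y where p: "p = (x, y)" and xy: "cross_inv t p = (a, b)" by (metis surj_pair)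
  have e: "a\<^sup>2 - 2 * b = x\<^sup>2 + 2 * y" using cross_inv_energy xy p by blast
  have "a = - x - t - 2 * sqrt (x\<^sup>2 + 2 * y)"
    using xy by (auto simp: p cross_inv_def Let_def)
  then have a: "- a - t - 2 * sqrt (x\<^sup>2 + 2 * y) = x" "a + t + 2 * sqrt (x\<^sup>2 + 2 * y) = - x"
    by simp_all
  show ?thesis
    unfolding p xy[unfolded p] by (simp add: cross_map_def Let_def e a)
qed

lemma continuous_on_cross_map: "continuous_on A (cross_map t)"
  unfolding cross_map_def split_beta Let_def by (intro continuous_intros) auto

lemma continuous_on_cross_inv: "continuous_on A (cross_inv t)"
  unfolding cross_inv_def split_beta Let_def by (intro continuous_intros) auto

lemma continuous_on_Phi: "continuous_on A (Phi_minus t)" "continuous_on A (Phi_plus t)"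
  unfolding Phi_minus_def Phi_plus_def split_beta by (intro continuous_intros; simp)+

lemma Phi_plus_uminus: "Phi_plus (- t) (Phi_plus t p) = p"
  by (cases p) (simp add: Phi_plus_def power2_eq_square field_simps)

lemma Phi_minus_uminus: "Phi_minus (- t) (Phi_minus t p) = p"
  by (cases p) (simp add: Phi_minus_def power2_eq_square field_simps)

lemma inj_flows: "inj (Phi_minus t)" "inj (Phi_plus t)" "inj (cross_map t)"
  using Phi_minus_uminus Phi_plus_uminus cross_inv_cross_map by (metis injI)+

lemma Psi_eq_cross_map:
  assumes "2 * b \<le> a\<^sup>2" shows "Psi t (a, b) = cross_map t (a, b)"
proof -
  \<comment> \<open>The crossing time is \<open>- a - s\<close>, so \<open>- s\<close> is the first
    coordinate at the moment of crossing.\<close>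
  define s where "s = sqrt (a\<^sup>2 - 2 * b)"
  have "s\<^sup>2 = a\<^sup>2 - 2 * b" using assms by (simp add: s_def)
  moreover have "(- s) * (t + a + s) - (t + a + s)\<^sup>2 / 2 = (s\<^sup>2 - (a + t + 2 * s)\<^sup>2) / 2"
    by (simp add: power2_eq_square field_simps)
  moreover have "Psi t (a, b) = (- a - t - 2 * s, (- s) * (t + a + s) - (t + a + s)\<^sup>2 / 2)"
    by (simp add: Psi_def cross_time_def flip: s_def) (simp add: algebra_simps)
  moreover have "cross_map t (a, b) = (- a - t - 2 * s, (a\<^sup>2 - 2 * b - (a + t + 2 * s)\<^sup>2) / 2)"
    unfolding cross_map_def Let_def s_def by simp
  ultimately show ?thesis by simp
qed

text \<open>On the axis with \<open>a \<le> 0\<close> the crossing time is 0. This is the gluing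
  condition for \<open>fall\<close>.\<close>

lemma cross_map_axis: "a \<le> 0 \<Longrightarrow> cross_map t (a, 0) = Phi_minus t (a, 0)"
proof -
  assume "a \<le> 0"
  then have "sqrt (a\<^sup>2 - 2 * 0) = - a" by simp
  then have "cross_map t (a, 0) = (- a - t - 2 * (- a), (a\<^sup>2 - 2 * 0 - (a + t + 2 * (- a))\<^sup>2) / 2)"
    unfolding cross_map_def Let_def by (simp only: prod.case)
  then show ?thesis
    by (simp add: Phi_minus_def power2_eq_square field_simps)
qed

lemma continuous_on_fall:
  assumes "A \<subseteq> {p. fst p \<le> 0}" shows "continuous_on A (fall t)"
proof -
  have "continuous_on (({p. fst p \<le> 0} \<inter> {p. snd p \<le> 0}) \<union> ({p. fst p \<le> 0} \<inter> {p. 0 \<le> snd p}))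
      (\<lambda>p. if snd p \<le> 0 then Phi_minus t p else cross_map t p)"
    by (intro continuous_on_cases continuous_on_Phi continuous_on_cross_map closed_Int
          closed_Collect_le continuous_intros)
       (auto simp: cross_map_axis)
  then show ?thesis
    unfolding fall_def by (rule continuous_on_subset) (use assms in auto)
qed

text \<open>For a point \<open>(x, y)\<close> on the left, \<open>- x - sqrt (x\<^sup>2 + 2 * y)\<close> is the time elapsed since the
  trajectory ending there crossed the axis; comparing it with \<open>t\<close> separates the two branches.\<close>

lemma fall_elapsed:
  assumes "a \<le> 0" "fall t (a, b) = (x, y)"
  shows "t \<le> - x - sqrt (x\<^sup>2 + 2 * y) \<longleftrightarrow> b \<le> 0"
proof (cases "b \<le> 0")
  case True
  then have xy: "x = a - t" "y = b + t * a - t\<^sup>2 / 2"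
    using assms by (auto simp: fall_def Phi_minus_def)
  have "sqrt (x\<^sup>2 + 2 * y) \<le> sqrt (a\<^sup>2)"
    using True by (intro real_sqrt_le_mono) (simp add: xy power2_eq_square field_simps)
  then show ?thesis using True assms by (simp add: xy)
next
  case False
  then have *: "cross_map t (a, b) = (x, y)" using assms by (auto simp: fall_def)
  have "sqrt (a\<^sup>2 - 2 * b) < sqrt (a\<^sup>2)"
    using False by (intro real_sqrt_less_mono) simp
  moreover have "x = - a - t - 2 * sqrt (a\<^sup>2 - 2 * b)"
    using * by (simp add: cross_map_def Let_def)
  moreover have "sqrt (x\<^sup>2 + 2 * y) = sqrt (a\<^sup>2 - 2 * b)"
    by (simp add: cross_map_energy[OF *])
  moreover have "sqrt (a\<^sup>2) = - a"
    using assms by simp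
  ultimately show ?thesis
    using False by linarith
qed

text \<open>By \<open>fall_elapsed\<close> the image reveals which branch produced it, and each
  branch is injective.\<close>

lemma inj_on_fall:
  assumes "A \<subseteq> {p. fst p \<le> 0}" shows "inj_on (fall t) A"
proof (rule inj_onI, clarify)
  fix a b a' b' assume A: "(a, b) \<in> A" "(a', b') \<in> A" and eq: "fall t (a, b) = fall t (a', b')"
  obtain x y where xy: "fall t (a, b) = (x, y)" by fastforce
  have "b \<le> 0 \<longleftrightarrow> b' \<le> 0"
    using fall_elapsed[of a t b x y] fall_elapsed[of a' t b' x y] assms[THEN subsetD, OF A(1)]
      assms[THEN subsetD, OF A(2)] xy eq by simp
  then show "a = a' \<and> b = b'"
    using eq inj_flows[THEN injD, of t "(a, b)" "(a', b')"] by (auto simp: fall_def split: if_splits)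
qed

section \<open>The two halves of the attainable set\<close>

lemma hypo_fst_le: "hypo t \<subseteq> {p. fst p \<le> 0}" and cap_fst_le: "cap t \<subseteq> {p. fst p \<le> 0}"
  using G0_fst_bounds by (auto simp: hypo_def cap_def)

lemma open_hypo_subset: "open_hypo t \<subseteq> hypo t"
  using interior_subset by (auto simp: open_hypo_def hypo_def)

text \<open>This is what the threshold encodes. If \<open>a \<ge> - t\<close>, then even the vertex
  time \<open>- a\<close> is at most \<open>t\<close>; otherwise the bound amounts to comparing the
  radicand with \<open>(a + t)\<^sup>2\<close>.\<close>

lemma cross_time_le:
  assumes "0 < t" "a \<le> 0" "b \<le> threshold t a" shows "- a - sqrt (a\<^sup>2 - 2 * b) \<le> t"
proof (cases "- t \<le> a")
  case True
  then have "0 \<le> sqrt (a\<^sup>2 - 2 * b)" using assms by (simp add: threshold_right)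
  then show ?thesis using True by linarith
next
  case False
  then have "(- a - t)\<^sup>2 \<le> a\<^sup>2 - 2 * b"
    using assms by (simp add: threshold_left power2_eq_square algebra_simps)
  then show ?thesis using False real_le_rsqrt by fastforce
qed

lemma cross_time_less:
  assumes "0 < t" "a < 0" "b < threshold t a" shows "- a - sqrt (a\<^sup>2 - 2 * b) < t"
proof (cases "- t \<le> a")
  case True
  then have "0 < sqrt (a\<^sup>2 - 2 * b)" using assms by (simp add: threshold_right)
  then show ?thesis using True by linarith
next
  case False
  then have "(- a - t)\<^sup>2 < a\<^sup>2 - 2 * b"
    using assms by (simp add: threshold_left power2_eq_square algebra_simps)
  then show ?thesis using False real_less_rsqrt by fastforce
qed

text \<open>After the crossing at \<open>- s\<close> the first coordinate only decreases, whence
  \<open>s \<le> - x\<close>. With the energy identity \<open>x\<^sup>2 + 2 * y = s\<^sup>2\<close>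
  this yields both bounds on \<open>y\<close>.\<close>

lemma cross_map_signs:
  assumes t: "0 < t" "a \<le> 0" "b \<le> threshold t a" and xy: "cross_map t (a, b) = (x, y)"
  shows "sqrt (x\<^sup>2 + 2 * y) \<le> - x" "x \<le> 0" "y \<le> 0" "- (x\<^sup>2 / 2) \<le> y"
proof -
  define s where "s = sqrt (a\<^sup>2 - 2 * b)"
  have nn: "0 \<le> a\<^sup>2 - 2 * b" using t threshold_le[of t a] by simp
  then have s: "0 \<le> s" "s\<^sup>2 = a\<^sup>2 - 2 * b" by (auto simp: s_def)
  have e: "x\<^sup>2 + 2 * y = s\<^sup>2" using cross_map_energy[OF xy] s by simp
  have x: "x = - a - t - 2 * s" using xy by (auto simp: cross_map_def Let_def s_def)
  have "- a - s \<le> t" using cross_time_le[OF t] by (simp add: s_def)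
  then have sx: "s \<le> - x" using x by simp
  moreover have "sqrt (x\<^sup>2 + 2 * y) = s" unfolding e using s(1) by simp
  ultimately show "sqrt (x\<^sup>2 + 2 * y) \<le> - x" "x \<le> 0" using s(1) by simp_all
  have "s\<^sup>2 \<le> (- x)\<^sup>2" using sx s by (intro power_mono) auto
  then show "y \<le> 0" using e by simp
  have "0 \<le> s\<^sup>2" by simp
  then show "- (x\<^sup>2 / 2) \<le> y" unfolding e[symmetric] by simp
qed

text \<open>The branch \<open>Phi_minus\<close> lands in \<open>x \<le> - t\<close>, so the strip
  \<open>- t < x\<close> only sees trajectories that have crossed the axis. The lower bound by the
  parabola is confined to that strip for this reason.\<close>

lemma fall_signs:
  assumes t: "0 < t" and ab: "(a, b) \<in> hypo t" and xy: "fall t (a, b) = (x, y)"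
  shows "x \<le> 0" "y \<le> 0" "- t < x \<Longrightarrow> - (x\<^sup>2 / 2) \<le> y" "x = 0 \<Longrightarrow> y = 0" "- t < x \<Longrightarrow> 0 < b"
proof -
  have a: "a \<le> 0" and b: "b \<le> threshold t a"
    using ab hypo_fst_le[of t] by (auto simp: hypo_def)
  have "x \<le> 0 \<and> y \<le> 0 \<and> (- t < x \<longrightarrow> - (x\<^sup>2 / 2) \<le> y) \<and> (x = 0 \<longrightarrow> y = 0) \<and> (- t < x \<longrightarrow> 0 < b)"
  proof (cases "b \<le> 0")
    case True
    then have "x = a - t" "y = b + t * a - t\<^sup>2 / 2"
      using xy by (auto simp: fall_def Phi_minus_def)
    moreover have "t * a \<le> 0" using t a by (simp add: mult_nonneg_nonpos)
    moreover have "0 \<le> t\<^sup>2" by simp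
    ultimately have "x \<le> - t" "y \<le> 0" using a True by linarith+
    then show ?thesis using t by auto
  next
    case False
    then have "cross_map t (a, b) = (x, y)" using xy by (auto simp: fall_def)
    note * = cross_map_signs[OF t a b this]
    have "x = 0 \<longrightarrow> y = 0" using *(3,4) by auto
    then show ?thesis using * False by auto
  qed
  then show "x \<le> 0" "y \<le> 0" "- t < x \<Longrightarrow> - (x\<^sup>2 / 2) \<le> y" "x = 0 \<Longrightarrow> y = 0" "- t < x \<Longrightarrow> 0 < b"
    by auto
qed

lemma fall_open_hypo_neg:
  assumes t: "0 < t" and ab: "(a, b) \<in> open_hypo t" and xy: "fall t (a, b) = (x, y)"
  shows "y < 0" "x < 0"
proof -
  have a: "a < 0" and b: "b < threshold t a"
    using ab open_hypo_fst by (auto simp: open_hypo_def)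
  have "y < 0"
  proof (cases "b \<le> 0")
    case True
    then have "y = b + t * a - t\<^sup>2 / 2"
      using xy by (auto simp: fall_def Phi_minus_def)
    moreover have "t * a < 0" using t a by (simp add: mult_pos_neg)
    moreover have "0 \<le> t\<^sup>2" by simp
    ultimately show ?thesis using True by linarith
  next
    case False
    then have c: "cross_map t (a, b) = (x, y)" using xy by (auto simp: fall_def)
    define s where "s = sqrt (a\<^sup>2 - 2 * b)"
    have nn: "0 \<le> a\<^sup>2 - 2 * b" using b threshold_le[of t a] by simp
    then have s: "0 \<le> s" "s\<^sup>2 = a\<^sup>2 - 2 * b" by (auto simp: s_def)
    have "x = - a - t - 2 * s" using c by (auto simp: cross_map_def Let_def s_def)
    then have "s < - x" using cross_time_less[OF t a b] by (simp add: s_def)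
    then have "s\<^sup>2 < (- x)\<^sup>2" using s by (intro power_strict_mono) auto
    then show ?thesis using cross_map_energy[OF c] s by simp
  qed
  moreover have "x \<le> 0" "x = 0 \<Longrightarrow> y = 0"
    using fall_signs[OF t _ xy] ab open_hypo_subset by auto
  ultimately show "y < 0" "x < 0" by force+
qed

text \<open>\<open>Phi_plus t\<close> carries the threshold curve to the axis for
  \<open>x \<le> 0\<close> and to the half parabola \<open>y = x\<^sup>2 / 2\<close> for
  \<open>x \<ge> 0\<close>.\<close>

lemma Phi_plus_cap_signs:
  assumes t: "0 < t" and ab: "(a, b) \<in> cap t" and xy: "Phi_plus t (a, b) = (x, y)"
  shows "0 \<le> y" "0 \<le> x \<Longrightarrow> x\<^sup>2 / 2 \<le> y" "x \<le> t"
proof -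
  have a: "a \<le> 0" and b: "threshold t a \<le> b"
    using ab cap_fst_le[of t] by (auto simp: cap_def)
  have x: "x = a + t" and y: "y = b + t * a + t\<^sup>2 / 2"
    using xy by (auto simp: Phi_plus_def)
  show par: "x\<^sup>2 / 2 \<le> y" if "0 \<le> x"
    using b that by (simp add: x y threshold_right power2_eq_square field_simps)
  show "x \<le> t" using a x by simp
  show "0 \<le> y"
  proof (cases "0 \<le> x")
    case True
    have "0 \<le> x\<^sup>2 / 2" by simp
    then show ?thesis using par True by linarith
  next
    case False
    then show ?thesis using b by (simp add: x y threshold_left algebra_simps)
  qed
qed

text \<open>At energy 0 the square root vanishes. If \<open>a \<ge> - t\<close>, the trajectory
  reaches the origin at time \<open>- a\<close> and spends the remaining time \<open>a + t\<close>
  on the lower arc.\<close>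

lemma cross_map_parabola:
  assumes "a \<le> 0"
  shows "cross_map t (a, a\<^sup>2 / 2) = (- (a + t), - ((a + t)\<^sup>2 / 2))"
  by (simp add: cross_map_def Let_def)

lemma Phi_plus_parabola: "Phi_plus t (a, a\<^sup>2 / 2) = (a + t, (a + t)\<^sup>2 / 2)"
  by (simp add: Phi_plus_def power2_eq_square field_simps)

text \<open>Closing the pieces only adds points already present in one of the other parts.\<close>

lemma G_eq:
  assumes t: "0 < t"
  shows "G t = Phi_plus t ` cap t \<union> fall t ` hypo t \<union> P_plus t \<union> P_minus t" (is "_ = ?R")
proof
  show "G t \<subseteq> ?R"
  proof -
    have "Phi_minus t ` G0_minus \<subseteq> fall t ` hypo t"
    proof (rule image_subsetI, clarify)
      fix a b assume "(a, b) \<in> G0_minus"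
      then have ab: "(a, b) \<in> G0" "b \<le> 0" by (auto simp: G0_minus_def)
      then have "(a, b) \<in> hypo t"
        using threshold_nonneg[OF t, of a] G0_fst_bounds[of a b] by (auto simp: hypo_def)
      moreover have "Phi_minus t (a, b) = fall t (a, b)" using ab by (simp add: fall_def)
      ultimately show "Phi_minus t (a, b) \<in> fall t ` hypo t" by simp
    qed
    moreover have "Psi t ` G0_cross t \<subseteq> fall t ` hypo t"
    proof (rule image_subsetI, clarify)
      fix a b assume "(a, b) \<in> G0_cross t"
      then have ab: "(a, b) \<in> G0" "b > 0" "b < threshold t a" by (auto simp: G0_cross_def)
      then have "(a, b) \<in> hypo t" by (auto simp: hypo_def)
      moreover have "Psi t (a, b) = fall t (a, b)"
        using ab threshold_le[of t a] by (simp add: fall_def Psi_eq_cross_map)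
      ultimately show "Psi t (a, b) \<in> fall t ` hypo t" by simp
    qed
    moreover have "G0_plus t \<subseteq> cap t" by (auto simp: G0_plus_def cap_def)
    ultimately show ?thesis unfolding G_def by blast
  qed
  have capG: "Phi_plus t (a, b) \<in> G t" if ab: "(a, b) \<in> cap t" for a b
  proof (cases "a < 0")
    case True
    then have "(a, b) \<in> G0_plus t"
      using threshold_pos[OF t True] ab by (auto simp: G0_plus_def cap_def)
    then show ?thesis by (simp add: G_def)
  next
    case False
    then have "a = 0" using ab cap_fst_le[of t] by auto
    moreover have "b = 0" using ab \<open>a = 0\<close> by (simp add: cap_def mem_G0)
    ultimately show ?thesis
      using t by (auto simp: G_def P_plus_def Phi_plus_def)
  qed
  have "fall t (a, b) \<in> G t" if ab: "(a, b) \<in> hypo t" for a b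
  proof -
    have a: "a \<le> 0" and b: "b \<le> threshold t a" and ab0: "(a, b) \<in> G0"
      using ab hypo_fst_le[of t] by (auto simp: hypo_def)
    consider "b \<le> 0" | "0 < b" "b < threshold t a" | "0 < b" "b = threshold t a" "- t \<le> a"
      | "0 < b" "b = threshold t a" "a < - t"
      using b by linarith
    then show ?thesis
    proof cases
      case 1
      then show ?thesis using ab0 by (auto simp: fall_def G_def G0_minus_def)
    next
      case 2
      then have "(a, b) \<in> G0_cross t" using ab0 by (auto simp: G0_cross_def)
      moreover have "fall t (a, b) = Psi t (a, b)"
        using 2 threshold_le[of t a] by (simp add: fall_def Psi_eq_cross_map)
      ultimately show ?thesis by (simp add: G_def)
    next
      case 3
      then have b': "b = a\<^sup>2 / 2" by (simp add: threshold_right)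
      have "fall t (a, b) = cross_map t (a, b)" using 3(1) by (simp add: fall_def)
      also have "\<dots> = (- (a + t), - ((a + t)\<^sup>2 / 2))" unfolding b' by (rule cross_map_parabola[OF a])
      finally have "fall t (a, b) = (- (a + t), - ((a + t)\<^sup>2 / 2))" .
      then have "fall t (a, b) \<in> P_minus t" using 3 a by (force simp: P_minus_def)
      then show ?thesis by (simp add: G_def)
    next
      \<comment> \<open>On the straight part of the threshold the crossing time is exactly
        \<open>t\<close>. Both flows give \<open>(a + t, 0)\<close>, so the point is already in the
        image of the cap.\<close>
      case 4
      then have b': "b = - a * t - t\<^sup>2 / 2" by (simp add: threshold_left)
      have e: "a\<^sup>2 - 2 * b = (a + t)\<^sup>2" by (simp add: b' power2_eq_square algebra_simps)
      have "sqrt ((a + t)\<^sup>2) = - (a + t)" using 4 by simp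
      then have "cross_map t (a, b) = (- a - t - 2 * (- (a + t)), ((a + t)\<^sup>2 - (a + t + 2 * (- (a + t)))\<^sup>2) / 2)"
        unfolding cross_map_def Let_def by (simp only: prod.case e)
      also have "\<dots> = (a + t, 0)"
        by (simp add: power2_eq_square algebra_simps)
      finally have "fall t (a, b) = (a + t, 0)"
        using 4(1) by (simp add: fall_def)
      moreover have "Phi_plus t (a, b) = (a + t, 0)"
        by (simp add: Phi_plus_def b' algebra_simps)
      moreover have "(a, b) \<in> cap t" using ab0 4 by (simp add: cap_def)
      ultimately show ?thesis using capG by metis
    qed
  qed
  then have "fall t ` hypo t \<subseteq> G t" by auto
  moreover have "Phi_plus t ` cap t \<subseteq> G t" using capG by auto
  moreover have "P_plus t \<union> P_minus t \<subseteq> G t" by (auto simp: G_def)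
  ultimately show "?R \<subseteq> G t" by blast
qed

section \<open>Open cores of the two images and the sandwich for the interior\<close>

definition G_up :: "real \<Rightarrow> (real \<times> real) set" where
  "G_up t = Phi_plus t ` interior (cap t)"

definition G_down :: "real \<Rightarrow> (real \<times> real) set" where
  "G_down t = fall t ` open_hypo t"

lemma open_hypo_fst_le: "open_hypo t \<subseteq> {p. fst p \<le> 0}"
  using open_hypo_subset hypo_fst_le by blast

text \<open>Invariance of domain: both maps are continuous and injective on open planar sets, which
  also covers the piecewise map \<open>fall\<close>.\<close>

lemma open_G_up: "open (G_up t)" and open_G_down: "open (G_down t)"
proof -
  show "open (G_up t)"
    unfolding G_up_def
    by (intro invariance_of_domain continuous_on_Phi open_interior inj_on_subset[OF inj_flows(2)]) auto
  show "open (G_down t)"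
    unfolding G_down_def
    by (intro invariance_of_domain continuous_on_fall inj_on_fall open_open_hypo open_hypo_fst_le)
qed

lemma connected_G_up: "connected (G_up t)"
  unfolding G_up_def
  by (intro connected_continuous_image continuous_on_Phi convex_connected convex_interior convex_cap)

lemma connected_G_down: "0 < t \<Longrightarrow> connected (G_down t)"
  unfolding G_down_def
  by (intro connected_continuous_image continuous_on_fall connected_open_hypo open_hypo_fst_le)

lemma closure_compact_image:
  fixes f :: "'a::heine_borel \<Rightarrow> 'b::heine_borel"
  assumes "continuous_on K f" "compact K" "closure U = K"
  shows "closure (f ` U) = f ` K"
proof
  have "U \<subseteq> K" using assms closure_subset by blast
  moreover have "closed (f ` K)" using assms by (intro compact_imp_closed compact_continuous_image)
  ultimately show "closure (f ` U) \<subseteq> f ` K" by (intro closure_minimal image_mono)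
  show "f ` K \<subseteq> closure (f ` U)"
    using image_closure_subset[of U f "closure (f ` U)"] assms closure_subset[of "f ` U"] by simp
qed

lemma closure_G_up: "0 < t \<Longrightarrow> closure (G_up t) = Phi_plus t ` cap t"
  unfolding G_up_def
  by (intro closure_compact_image continuous_on_Phi compact_cap closure_interior_cap)

lemma closure_G_down: "0 < t \<Longrightarrow> closure (G_down t) = fall t ` hypo t"
  unfolding G_down_def
  by (intro closure_compact_image continuous_on_fall compact_hypo closure_open_hypo hypo_fst_le)

lemma G_eq_closure:
  "0 < t \<Longrightarrow> G t = closure (G_up t) \<union> closure (G_down t) \<union> P_plus t \<union> P_minus t"
  by (simp add: G_eq closure_G_up closure_G_down)

lemma closure_G_up_signs:
  assumes "0 < t" "(x, y) \<in> closure (G_up t)"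
  shows "0 \<le> y" "0 \<le> x \<Longrightarrow> x\<^sup>2 / 2 \<le> y" "x \<le> t"
proof -
  obtain a b where "(a, b) \<in> cap t" "Phi_plus t (a, b) = (x, y)"
    using assms by (auto simp: closure_G_up)
  then show "0 \<le> y" "0 \<le> x \<Longrightarrow> x\<^sup>2 / 2 \<le> y" "x \<le> t"
    using Phi_plus_cap_signs assms(1) by blast+
qed

lemma closure_G_down_signs:
  assumes "0 < t" "(x, y) \<in> closure (G_down t)"
  shows "x \<le> 0" "y \<le> 0" "- t < x \<Longrightarrow> - (x\<^sup>2 / 2) \<le> y" "x = 0 \<Longrightarrow> y = 0"
proof -
  obtain a b where "(a, b) \<in> hypo t" "fall t (a, b) = (x, y)"
    using assms by (auto simp: closure_G_down)
  then show "x \<le> 0" "y \<le> 0" "- t < x \<Longrightarrow> - (x\<^sup>2 / 2) \<le> y" "x = 0 \<Longrightarrow> y = 0"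
    using fall_signs(1-4) assms(1) by blast+
qed

lemma G_down_neg:
  assumes "0 < t" "(x, y) \<in> G_down t" shows "y < 0" "x < 0"
proof -
  obtain a b where "(a, b) \<in> open_hypo t" "fall t (a, b) = (x, y)"
    using assms by (auto simp: G_down_def)
  then show "y < 0" "x < 0" using fall_open_hypo_neg assms(1) by blast+
qed

lemma G_up_nonempty: "0 < t \<Longrightarrow> G_up t \<noteq> {}" and G_down_nonempty: "0 < t \<Longrightarrow> G_down t \<noteq> {}"
  using interior_cap_nonempty axis_in_open_hypo[of t "- 1/2"] by (auto simp: G_up_def G_down_def)

lemma P_plus_eq: "P_plus t = (\<lambda>r. (r, r\<^sup>2 / 2)) ` {0..t}"
  and P_minus_eq: "P_minus t = (\<lambda>r. (- r, - (r\<^sup>2 / 2))) ` {0..t}"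
  by (auto simp: P_plus_def P_minus_def)

lemma compact_P: "compact (P_plus t)" "compact (P_minus t)"
  and connected_P: "connected (P_plus t)" "connected (P_minus t)"
  unfolding P_plus_eq P_minus_eq
  by (intro compact_continuous_image connected_continuous_image continuous_intros; simp)+

lemma compact_G:
  assumes "0 < t" shows "compact (G t)"
  unfolding G_eq[OF assms]
  by (intro compact_Un compact_P compact_continuous_image continuous_on_Phi continuous_on_fall
      compact_cap compact_hypo hypo_fst_le)

lemma open_vertical:
  fixes U :: "(real \<times> real) set"
  assumes "open U" "(x, y) \<in> U" "0 < (c::real)"
  obtains d where "0 < d" "d < c" "(x, y + d) \<in> U" "(x, y - d) \<in> U"
proof -
  obtain e where e: "0 < e" "ball (x, y) e \<subseteq> U" using assms open_contains_ball by blast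
  define d where "d = min e c / 2"
  have "0 < d" "d < c" "d < e" using e assms by (auto simp: d_def)
  moreover have "(x, y + d) \<in> ball (x, y) e" "(x, y - d) \<in> ball (x, y) e"
    using \<open>0 < d\<close> \<open>d < e\<close> by (auto simp: dist_Pair_Pair dist_real_def)
  ultimately show ?thesis using that e by blast
qed

text \<open>For the upper bound, interior points outside both closures would form an open subset of
  the two arcs. These lie on the single graph \<open>y = x * \<bar>x\<bar> / 2\<close>, which
  contains no vertical segment.\<close>

lemma interior_G_between:
  assumes t: "0 < t"
  shows "G_up t \<union> G_down t \<subseteq> interior (G t)"
    and "interior (G t) \<subseteq> closure (G_up t) \<union> closure (G_down t)"
proof -
  show "G_up t \<union> G_down t \<subseteq> interior (G t)"
    using closure_subset[of "G_up t"] closure_subset[of "G_down t"]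
    by (intro interior_maximal open_Un open_G_up open_G_down) (auto simp: G_eq_closure[OF t])
  show "interior (G t) \<subseteq> closure (G_up t) \<union> closure (G_down t)"
  proof (rule ccontr)
    define W where "W = interior (G t) - (closure (G_up t) \<union> closure (G_down t))"
    assume "\<not> ?thesis"
    then obtain x y where xy: "(x, y) \<in> W" by (auto simp: W_def)
    have W: "open W" unfolding W_def by (intro open_Diff open_interior closed_Un closed_closure)
    have WP: "W \<subseteq> P_plus t \<union> P_minus t"
      using interior_subset[of "G t"] by (auto simp: W_def G_eq_closure[OF t])
    have y: "y = x * \<bar>x\<bar> / 2" if "(x, y) \<in> W" for x y
      using WP that by (fastforce simp: P_plus_def P_minus_def power2_eq_square)
    obtain d where "0 < d" "d < 1" "(x, y + d) \<in> W"
      using open_vertical[OF W xy zero_less_one] by blast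
    then show False using y[OF xy] y[of x "y + d"] by linarith
  qed
qed

section \<open>Area\<close>

abbreviation measure_pres :: "(real \<times> real \<Rightarrow> real \<times> real) \<Rightarrow> bool" where
  "measure_pres f \<equiv> f \<in> borel_measurable borel \<and> distr lborel borel f = lborel"

abbreviation shear :: "real \<Rightarrow> (real \<Rightarrow> real) \<Rightarrow> real \<times> real \<Rightarrow> real \<times> real" where
  "shear c g \<equiv> \<lambda>p. (fst p, c * snd p + g (fst p))"

lemma emeasure_lborel_Pair:
  "X \<in> sets (borel :: (real \<times> real) measure) \<Longrightarrow>
    emeasure lborel X = (\<integral>\<^sup>+x. emeasure lborel (Pair x -` X) \<partial>lborel)"
  using lborel.emeasure_pair_measure_alt[of X lborel] unfolding lborel_prod by simp

text \<open>Cavalieri's principle: each vertical section is moved by a translation or a reflection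
  of the line. No Jacobian enters, which suits the square root in \<open>cross_map\<close>, since it
  is not differentiable at 0.\<close>

lemma measure_pres_shear:
  assumes c: "\<bar>c\<bar> = 1" and g[measurable]: "g \<in> borel_measurable borel"
  shows "measure_pres (shear c g)"
proof
  show f[measurable]: "shear c g \<in> borel_measurable borel"
    unfolding borel_prod[symmetric] by measurable
  have aff: "distr lborel borel (\<lambda>x. t + c * x) = lborel" for t
    using lborel_real_affine[of c t] c by (auto simp: density_1)
  show "distr lborel borel (shear c g) = lborel"
  proof (rule measure_eqI)
    fix X assume "X \<in> sets (distr lborel borel (shear c g))"
    then have X[measurable]: "X \<in> sets borel" by simp
    have sec: "emeasure lborel (Pair x -` (shear c g -` X)) = emeasure lborel (Pair x -` X)" for x
    proof -
      have Y: "Pair x -` X \<in> sets borel"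
        using X sets_Pair1[of X lborel lborel x] unfolding lborel_prod by simp
      have "emeasure lborel (Pair x -` X) = emeasure (distr lborel borel (\<lambda>b. g x + c * b)) (Pair x -` X)"
        by (simp add: aff)
      also have "\<dots> = emeasure lborel ((\<lambda>b. g x + c * b) -` (Pair x -` X) \<inter> space lborel)"
        using Y by (intro emeasure_distr) auto
      also have "(\<lambda>b. g x + c * b) -` (Pair x -` X) \<inter> space lborel = Pair x -` (shear c g -` X)"
        by (auto simp: add.commute)
      finally show ?thesis by simp
    qed
    have pre: "shear c g -` X \<in> sets borel"
      using measurable_sets[OF f X] by simp
    have "emeasure (distr lborel borel (shear c g)) X = emeasure lborel (shear c g -` X)"
      by (subst emeasure_distr) auto
    also have "\<dots> = emeasure lborel X"
      by (simp add: emeasure_lborel_Pair[OF X] emeasure_lborel_Pair[OF pre] sec)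
    finally show "emeasure (distr lborel borel (shear c g)) X = emeasure lborel X" .
  qed simp
qed

lemma measure_pres_comp: "measure_pres f \<Longrightarrow> measure_pres g \<Longrightarrow> measure_pres (g \<circ> f)"
  using distr_distr[of g borel borel f lborel] by (auto intro: measurable_comp)

lemma measure_pres_swap: "measure_pres prod.swap"
proof
  show m: "prod.swap \<in> borel_measurable (borel :: (real \<times> real) measure)"
    unfolding borel_prod[symmetric] prod.swap_def by measurable
  have "distr lborel lborel (\<lambda>(x, y). (y, x)) = (lborel :: (real \<times> real) measure)"
    using lborel_pair.distr_pair_swap unfolding lborel_prod by (rule sym)
  moreover have "(\<lambda>(x, y). (y, x)) = (prod.swap :: real \<times> real \<Rightarrow> _)" by auto
  moreover have "distr lborel borel prod.swap = distr lborel lborel (prod.swap :: real \<times> real \<Rightarrow> _)"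
    by (rule distr_cong) auto
  ultimately show "distr lborel borel prod.swap = (lborel :: (real \<times> real) measure)" by simp
qed

lemma measure_pres_flows:
  shows "measure_pres (Phi_plus t)" "measure_pres (Phi_minus t)" "measure_pres (cross_map t)"
proof -
  have "measure_pres (prod.swap \<circ> (shear 1 (\<lambda>_. t) \<circ> (prod.swap \<circ> shear 1 (\<lambda>a. t * a + t\<^sup>2 / 2))))"
    by (intro measure_pres_comp measure_pres_shear measure_pres_swap) auto
  also have "prod.swap \<circ> (shear 1 (\<lambda>_. t) \<circ> (prod.swap \<circ> shear 1 (\<lambda>a. t * a + t\<^sup>2 / 2))) = Phi_plus t"
    by (auto simp: Phi_plus_def fun_eq_iff)
  finally show "measure_pres (Phi_plus t)" .
  have "measure_pres (prod.swap \<circ> (shear 1 (\<lambda>_. - t) \<circ> (prod.swap \<circ> shear 1 (\<lambda>a. t * a - t\<^sup>2 / 2))))"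
    by (intro measure_pres_comp measure_pres_shear measure_pres_swap) auto
  also have "prod.swap \<circ> (shear 1 (\<lambda>_. - t) \<circ> (prod.swap \<circ> shear 1 (\<lambda>a. t * a - t\<^sup>2 / 2))) = Phi_minus t"
    by (auto simp: Phi_minus_def fun_eq_iff)
  finally show "measure_pres (Phi_minus t)" .
  \<comment> \<open>Straightening the arcs by \<open>u = b - a\<^sup>2 / 2\<close> turns the
    crossing into the reflection of \<open>a\<close> to \<open>- a - t - 2 * sqrt (- 2 * u)\<close>
    on each level of \<open>u\<close>; the outer shear bends the levels into the arcs
    \<open>y + x\<^sup>2 / 2 = - u\<close>.\<close>
  let ?S = "shear (- 1) (\<lambda>x. - (x\<^sup>2 / 2)) \<circ> (prod.swap \<circ> (shear (- 1) (\<lambda>u. - t - 2 * sqrt (- 2 * u)) \<circ>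
      (prod.swap \<circ> shear 1 (\<lambda>a. - (a\<^sup>2 / 2)))))"
  have "measure_pres ?S"
    by (intro measure_pres_comp measure_pres_shear measure_pres_swap) auto
  also have "?S = cross_map t"
  proof
    fix p :: "real \<times> real"
    obtain a b where p: "p = (a, b)" by fastforce
    define s where "s = sqrt (a\<^sup>2 - 2 * b)"
    have "?S p = (- t - 2 * s - a, - (b - a\<^sup>2 / 2) - (- t - 2 * s - a)\<^sup>2 / 2)"
      by (simp add: p s_def)
    also have "(- t - 2 * s - a)\<^sup>2 = (a + t + 2 * s)\<^sup>2"
      by (simp add: power2_eq_square algebra_simps)
    finally show "?S p = cross_map t p"
      unfolding p cross_map_def Let_def prod.case s_def by (simp add: diff_divide_distrib)
  qed
  finally show "measure_pres (cross_map t)" .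
qed

text \<open>The measurable inverse \<open>g\<close> turns images into preimages, so that images of
  Borel sets are Borel.\<close>

lemma emeasure_image:
  assumes f: "measure_pres f" and g: "g \<in> borel_measurable borel"
    and "\<And>p. g (f p) = p" "\<And>p. f (g p) = p" and X: "X \<in> sets borel"
  shows "f ` X \<in> sets borel" "emeasure lborel (f ` X) = emeasure lborel X"
proof -
  have "f ` X = g -` X \<inter> space borel"
    by (auto simp: assms(3)) (metis assms(4) image_eqI)
  then show fX: "f ` X \<in> sets borel" using measurable_sets[OF g X] by simp
  have "emeasure lborel (f ` X) = emeasure (distr lborel borel f) (f ` X)" using f by simp
  also have "\<dots> = emeasure lborel (f -` f ` X \<inter> space lborel)"
    using f fX by (intro emeasure_distr) auto
  also have "f -` f ` X \<inter> space lborel = X"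
    by (auto, metis assms(3))
  finally show "emeasure lborel (f ` X) = emeasure lborel X" .
qed

lemma Phi_plus_uminus': "Phi_plus t (Phi_plus (- t) p) = p"
  and Phi_minus_uminus': "Phi_minus t (Phi_minus (- t) p) = p"
  using Phi_plus_uminus[of "- t"] Phi_minus_uminus[of "- t"] by simp_all

lemmas emeasure_Phi_plus = emeasure_image[OF measure_pres_flows(1)
  borel_measurable_continuous_onI[OF continuous_on_Phi(2)] Phi_plus_uminus Phi_plus_uminus']

lemmas emeasure_Phi_minus = emeasure_image[OF measure_pres_flows(2)
  borel_measurable_continuous_onI[OF continuous_on_Phi(1)] Phi_minus_uminus Phi_minus_uminus']

lemmas emeasure_cross_map = emeasure_image[OF measure_pres_flows(3)
  borel_measurable_continuous_onI[OF continuous_on_cross_inv] cross_inv_cross_map cross_map_cross_inv]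

lemma emeasure_fall:
  assumes X: "X \<in> sets borel" and le: "X \<subseteq> {p. fst p \<le> 0}"
  shows "emeasure lborel (fall t ` X) = emeasure lborel X"
proof -
  let ?A = "X \<inter> {p. snd p \<le> 0}" and ?B = "X - {p. snd p \<le> 0}"
  have "closed {p :: real \<times> real. snd p \<le> 0}"
    by (intro closed_Collect_le continuous_intros)
  then have m: "?A \<in> sets borel" "?B \<in> sets borel"
    using X by auto
  have A: "fall t ` ?A = Phi_minus t ` ?A" and B: "fall t ` ?B = cross_map t ` ?B"
    by (auto simp: fall_def image_iff)
  have "fall t ` X = fall t ` ?A \<union> fall t ` ?B" by blast
  moreover have "fall t ` ?A \<inter> fall t ` ?B = {}"
    using inj_on_image_Int[OF inj_on_fall[OF le], of ?A ?B t] by auto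
  ultimately have "emeasure lborel (fall t ` X) = emeasure lborel (fall t ` ?A) + emeasure lborel (fall t ` ?B)"
    unfolding A B
    using emeasure_Phi_minus(1)[OF m(1), of t] emeasure_cross_map(1)[OF m(2), of t]
    by (simp add: plus_emeasure)
  also have "\<dots> = emeasure lborel ?A + emeasure lborel ?B"
    unfolding A B by (simp add: emeasure_Phi_minus(2)[OF m(1)] emeasure_cross_map(2)[OF m(2)])
  also have "\<dots> = emeasure lborel (?A \<union> ?B)"
    using m by (intro plus_emeasure) auto
  also have "?A \<union> ?B = X" by blast
  finally show ?thesis .
qed

lemma emeasure_graph:
  fixes g :: "real \<Rightarrow> real"
  assumes g: "continuous_on UNIV g"
  shows "emeasure lborel {p. snd p = g (fst p)} = 0"
proof -
  let ?Z = "{p. snd p = g (fst p)}"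
  have cg: "continuous_on UNIV (\<lambda>p::real \<times> real. g (fst p))"
    by (rule continuous_on_compose2[OF g]) (auto intro: continuous_intros)
  have "closed ?Z" by (intro closed_Collect_eq continuous_intros cg)
  then have "?Z \<in> sets borel" by simp
  then have "emeasure lborel ?Z = (\<integral>\<^sup>+x. emeasure lborel (Pair x -` ?Z) \<partial>lborel)"
    by (rule emeasure_lborel_Pair)
  also have "\<dots> = 0"
  proof -
    have "Pair x -` ?Z = {g x}" for x by auto
    then show ?thesis by simp
  qed
  finally show ?thesis .
qed

lemma emeasure_frontier_convex:
  fixes S :: "(real \<times> real) set"
  assumes "convex S" shows "emeasure lborel (frontier S) = 0"
proof -
  have "frontier S \<in> null_sets lebesgue"
    using negligible_convex_frontier[OF assms] by (simp add: negligible_iff_null_sets)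
  moreover have "frontier S \<in> sets borel"
    by (simp add: frontier_closed)
  ultimately show ?thesis
    by (auto simp: null_sets_def)
qed

text \<open>Both ends of the sandwich have the area of the disc. The upper end counts only the
  threshold curve twice, a null graph; the lower end loses only the frontiers of the convex sets
  \<open>cap t\<close> and \<open>G0\<close>.\<close>

lemma emeasure_interior_G_pos:
  assumes t: "0 < t"
  shows "emeasure lborel (interior (G t)) = emeasure lborel G0"
proof (rule antisym)
  let ?m = "emeasure (lborel :: (real \<times> real) measure)"
  let ?H = "G0 - cap t"
  have borel: "cap t \<in> sets borel" "hypo t \<in> sets borel" "open_hypo t \<in> sets borel"
      "G0 \<in> sets borel" "interior (cap t) \<in> sets borel" "frontier G0 \<in> sets borel"
      "frontier (cap t) \<in> sets borel" "G_up t \<in> sets borel" "G_down t \<in> sets borel"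
    by (simp_all add: compact_imp_closed compact_cap compact_hypo compact_G0 open_open_hypo
        open_G_up open_G_down frontier_closed)
  have H: "?H \<in> sets borel" using borel by auto
  have split: "?m G0 = ?m (cap t) + ?m ?H"
  proof -
    have "cap t \<union> ?H = G0" by (auto simp: cap_def)
    then show ?thesis using plus_emeasure[of "cap t" lborel ?H] borel H by auto
  qed
  show "?m (interior (G t)) \<le> ?m G0"
  proof -
    let ?g = "{p. snd p = threshold t (fst p)}"
    have "closed ?g" by (intro closed_Collect_eq continuous_intros)
    then have g: "?g \<in> sets borel" by simp
    have "?m (hypo t) \<le> ?m (?H \<union> ?g)"
      using H g by (intro emeasure_mono) (auto simp: hypo_def cap_def)
    also have "\<dots> \<le> ?m ?H + ?m ?g"
      using H g by (intro emeasure_subadditive) auto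
    also have "?m ?g = 0" by (intro emeasure_graph continuous_intros)
    finally have h: "?m (hypo t) \<le> ?m ?H" by simp
    have "?m (interior (G t)) \<le> ?m (closure (G_up t) \<union> closure (G_down t))"
      by (intro emeasure_mono interior_G_between t) auto
    also have "\<dots> \<le> ?m (closure (G_up t)) + ?m (closure (G_down t))"
      by (intro emeasure_subadditive) auto
    also have "\<dots> = ?m (cap t) + ?m (hypo t)"
      unfolding closure_G_up[OF t] closure_G_down[OF t]
      using borel by (simp add: emeasure_Phi_plus emeasure_fall hypo_fst_le)
    also have "\<dots> \<le> ?m G0" unfolding split by (intro add_left_mono h)
    finally show ?thesis .
  qed
  have "?m (cap t) \<le> ?m (interior (cap t) \<union> frontier (cap t))"
    using borel closure_subset[of "cap t"] by (intro emeasure_mono) (auto simp: frontier_def)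
  also have "\<dots> \<le> ?m (interior (cap t)) + ?m (frontier (cap t))"
    using borel by (intro emeasure_subadditive) auto
  finally have c: "?m (cap t) \<le> ?m (interior (cap t))"
    by (simp add: emeasure_frontier_convex convex_cap)
  have "?m ?H \<le> ?m (open_hypo t \<union> frontier G0)"
    using borel closure_subset[of G0]
    by (intro emeasure_mono) (auto simp: frontier_def open_hypo_def cap_def)
  also have "\<dots> \<le> ?m (open_hypo t) + ?m (frontier G0)"
    using borel by (intro emeasure_subadditive) auto
  finally have h: "?m ?H \<le> ?m (open_hypo t)"
    by (simp add: emeasure_frontier_convex convex_G0)
  have disj: "G_up t \<inter> G_down t = {}"
  proof -
    have False if "(x, y) \<in> G_up t" "(x, y) \<in> G_down t" for x y
      using closure_G_up_signs(1)[OF t] G_down_neg(1)[OF t] that closure_subset by fastforce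
    then show ?thesis by auto
  qed
  have "?m G0 \<le> ?m (interior (cap t)) + ?m (open_hypo t)"
    unfolding split by (intro add_mono c h)
  also have "\<dots> = ?m (G_up t) + ?m (G_down t)"
    unfolding G_up_def G_down_def
    using borel by (simp add: emeasure_Phi_plus emeasure_fall open_hypo_fst_le)
  also have "\<dots> = ?m (G_up t \<union> G_down t)"
    using borel disj by (intro plus_emeasure) auto
  also have "\<dots> \<le> ?m (interior (G t))"
    by (intro emeasure_mono interior_G_between t) auto
  finally show "?m G0 \<le> ?m (interior (G t))" .
qed

text \<open>The area statement includes time 0. There the threshold vanishes for
  \<open>a \<le> 0\<close>, so nothing crosses, and both flows are the identity.\<close>

lemma G_zero: "G 0 = G0"
proof -
  have "G0_cross 0 = {}"
    using G0_fst_bounds by (force simp: G0_cross_def threshold_def)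
  moreover have "(a, b) \<in> G0_plus 0" if "(a, b) \<in> G0" "0 < b" for a b
    using that G0_fst_bounds[of a b] by (auto simp: G0_plus_def threshold_def)
  then have "G0_minus \<union> G0_plus 0 = G0"
    by (force simp: G0_minus_def G0_plus_def)
  moreover have "Phi_minus 0 = id" "Phi_plus 0 = id"
    by (auto simp: Phi_minus_def Phi_plus_def)
  moreover have "P_plus 0 = {(0, 0)}" "P_minus 0 = {(0, 0)}"
    by (auto simp: P_plus_def P_minus_def)
  moreover have "(0, 0) \<in> G0" by (simp add: mem_G0)
  ultimately show ?thesis unfolding G_def by auto
qed

lemma emeasure_interior_G:
  assumes "0 \<le> t"
  shows "emeasure lebesgue (interior (G t)) = emeasure lborel G0"
proof -
  have "emeasure lborel (interior (G t)) = emeasure lborel G0"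
  proof (cases "t = 0")
    case True
    have "emeasure lborel G0 \<le> emeasure lborel (interior G0 \<union> frontier G0)"
      using closure_subset[of G0] by (intro emeasure_mono) (auto simp: frontier_def)
    also have "\<dots> \<le> emeasure lborel (interior G0) + emeasure lborel (frontier G0)"
      by (intro emeasure_subadditive) (auto intro: borel_closed frontier_closed)
    finally have "emeasure lborel G0 \<le> emeasure lborel (interior G0)"
      by (simp add: emeasure_frontier_convex convex_G0)
    moreover have "emeasure lborel (interior G0) \<le> emeasure lborel G0"
      using compact_G0 by (intro emeasure_mono interior_subset) (auto intro: borel_closed compact_imp_closed)
    ultimately show ?thesis by (simp add: True G_zero)
  next
    case False
    then show ?thesis using assms by (intro emeasure_interior_G_pos) auto
  qed
  then show ?thesis by simp
qed

section \<open>Cones and Lipschitz boundaries\<close>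

lemma frame_pt_eq:
  "frame_pt p v x y = (fst p + x * fst v - y * snd v, snd p + x * snd v + y * fst v)"
  by (cases p; cases v) (simp add: frame_pt_def)

lemma frame_pt_coords:
  assumes "norm v = 1"
  shows "frame_pt p v ((q - p) \<bullet> v) ((q - p) \<bullet> (- snd v, fst v)) = q"
proof -
  obtain p1 p2 q1 q2 v1 v2 where [simp]: "p = (p1, p2)" "q = (q1, q2)" "v = (v1, v2)"
    by (metis surj_pair)
  have "v1\<^sup>2 + v2\<^sup>2 = 1"
    using assms by (simp add: norm_Pair)
  then have n: "v1 * v1 + v2 * v2 = 1" by (simp add: power2_eq_square)
  have "((q1 - p1) * v1 + (q2 - p2) * v2) * v1 - ((q1 - p1) * - v2 + (q2 - p2) * v1) * v2
      = (q1 - p1) * (v1 * v1 + v2 * v2)"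
    "((q1 - p1) * v1 + (q2 - p2) * v2) * v2 + ((q1 - p1) * - v2 + (q2 - p2) * v1) * v1
      = (q2 - p2) * (v1 * v1 + v2 * v2)"
    by (simp_all add: algebra_simps)
  then show ?thesis unfolding n by (simp add: frame_pt_eq inner_prod_def)
qed

lemma norm_eq_frame:
  fixes v z :: "real \<times> real"
  assumes "norm v = 1"
  shows "(norm z)\<^sup>2 = (z \<bullet> v)\<^sup>2 + (z \<bullet> (- snd v, fst v))\<^sup>2"
proof -
  obtain z1 z2 v1 v2 where [simp]: "z = (z1, z2)" "v = (v1, v2)" by (metis surj_pair)
  have "v1\<^sup>2 + v2\<^sup>2 = 1" using assms by (simp add: norm_Pair)
  moreover have "(z1 * v1 + z2 * v2)\<^sup>2 + (z1 * - v2 + z2 * v1)\<^sup>2 = (z1\<^sup>2 + z2\<^sup>2) * (v1\<^sup>2 + v2\<^sup>2)"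
    by (simp add: power2_eq_square algebra_simps)
  ultimately show ?thesis by (simp add: norm_Pair inner_prod_def)
qed

text \<open>In a narrow cone about the vertical direction of the frame, the vertical gain exceeds
  \<open>L\<close> times the horizontal displacement, so the graph of \<open>\<phi>\<close> cannot
  catch up. The contrapositive reduces both negative clauses of a cusp to the missing cone.\<close>

lemma lipschitz_boundary_imp_cone:
  assumes "lipschitz_boundary_at S p" shows "uniform_interior_cone_at S p"
proof -
  obtain v r h L \<phi> where v: "norm v = 1" and r: "0 < r" and h: "0 < h"
    and L: "L-lipschitz_on {-r<..<r} \<phi>"
    and S: "\<And>x y. \<bar>x\<bar> < r \<Longrightarrow> \<bar>y\<bar> < h \<Longrightarrow> frame_pt p v x y \<in> interior S \<longleftrightarrow> \<phi> x < y"
    using assms unfolding lipschitz_boundary_at_def by metis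
  define w where "w = (- snd v, fst v)"
  have w: "norm w = 1" using v by (cases v) (simp add: w_def norm_Pair add.commute)
  \<comment> \<open>Half the box: the vertex and the displacement within the cone each use up at
    most \<open>\<rho>\<close>.\<close>
  define \<rho> where "\<rho> = min r h / 2"
  have \<rho>: "0 < \<rho>" "2 * \<rho> \<le> r" "2 * \<rho> \<le> h" using r h by (auto simp: \<rho>_def)
  have L0: "0 \<le> L" using L by (rule lipschitz_on_nonneg)
  \<comment> \<open>Taking \<open>L + 1\<close> instead of \<open>L\<close> avoids a division by 0
    when \<open>L = 0\<close>.\<close>
  define \<theta> where "\<theta> = arctan (1 / (L + 1))"
  have \<theta>: "0 < \<theta>" "\<theta> < pi / 2" using L0 arctan_ubound by (auto simp: \<theta>_def)
  have bd: "\<bar>z \<bullet> v\<bar> \<le> norm z" "\<bar>z \<bullet> w\<bar> \<le> norm z" for z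
    using Cauchy_Schwarz_ineq2[of z v] Cauchy_Schwarz_ineq2[of z w] v w by auto
  have cone: "L * \<bar>z \<bullet> v\<bar> < z \<bullet> w" if z: "cos \<theta> * norm z < z \<bullet> w" for z
  proof -
    define k where "k = 1 / (L + 1)"
    have k: "0 < k" using L0 by (simp add: k_def)
    have "cos \<theta> = 1 / sqrt (1 + k\<^sup>2)" by (simp add: \<theta>_def k_def cos_arctan)
    moreover have "0 < 1 + k\<^sup>2" by (simp add: add_pos_nonneg)
    ultimately have c: "0 < cos \<theta>" "(cos \<theta>)\<^sup>2 * (1 + k\<^sup>2) = 1"
      by (simp_all add: power_divide)
    have "0 \<le> cos \<theta> * norm z" using c by simp
    then have zw: "0 < z \<bullet> w" using z by linarith
    have "(cos \<theta> * norm z)\<^sup>2 < (z \<bullet> w)\<^sup>2"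
      using z \<open>0 \<le> cos \<theta> * norm z\<close> by (intro power_strict_mono) auto
    then have "(cos \<theta> * norm z)\<^sup>2 * (1 + k\<^sup>2) < (z \<bullet> w)\<^sup>2 * (1 + k\<^sup>2)"
      by (intro mult_strict_right_mono) (auto simp: add_pos_nonneg)
    also have "(cos \<theta> * norm z)\<^sup>2 * (1 + k\<^sup>2) = ((cos \<theta>)\<^sup>2 * (1 + k\<^sup>2)) * (norm z)\<^sup>2"
      by (simp add: power_mult_distrib algebra_simps)
    also have "\<dots> = (z \<bullet> v)\<^sup>2 + (z \<bullet> w)\<^sup>2"
      unfolding c(2) using norm_eq_frame[OF v, of z] by (simp add: w_def)
    finally have "(z \<bullet> v)\<^sup>2 < (k * (z \<bullet> w))\<^sup>2"
      by (simp add: power_mult_distrib algebra_simps)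
    then have "\<bar>z \<bullet> v\<bar> < \<bar>k * (z \<bullet> w)\<bar>"
      by (metis abs_le_square_iff linorder_not_le)
    then have "\<bar>z \<bullet> v\<bar> < k * (z \<bullet> w)" using k zw by simp
    then have "(L + 1) * \<bar>z \<bullet> v\<bar> < (L + 1) * (k * (z \<bullet> w))"
      using L0 by (intro mult_strict_left_mono) auto
    also have "(L + 1) * (k * (z \<bullet> w)) = z \<bullet> w" using L0 by (simp add: k_def)
    finally show ?thesis by (simp add: algebra_simps)
  qed
  have "open_cone q w \<theta> \<rho> \<subseteq> interior S" if q: "q \<in> interior S \<inter> ball p \<rho>" for q
  proof
    fix u assume "u \<in> open_cone q w \<theta> \<rho>"
    then obtain z where u: "u = q + z" and z: "norm z < \<rho>" "cos \<theta> * norm z < z \<bullet> w"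
      by (auto simp: open_cone_def)
    have fr: "frame_pt p v ((q' - p) \<bullet> v) ((q' - p) \<bullet> w) = q'" for q'
      using frame_pt_coords[OF v] by (simp add: w_def)
    have qp: "norm (q - p) < \<rho>" using q by (simp add: dist_norm norm_minus_commute)
    let ?x = "(q - p) \<bullet> v" and ?y = "(q - p) \<bullet> w"
    have x: "\<bar>?x\<bar> < \<rho>" "\<bar>?y\<bar> < \<rho>" using bd[of "q - p"] qp by auto
    have uz: "(u - p) \<bullet> v = ?x + z \<bullet> v" "(u - p) \<bullet> w = ?y + z \<bullet> w"
      by (simp_all add: u inner_add_left inner_diff_left)
    have zb: "\<bar>z \<bullet> v\<bar> < \<rho>" "\<bar>z \<bullet> w\<bar> < \<rho>" using bd[of z] z by auto
    have "\<phi> ?x < ?y" using S[of ?x ?y] x \<rho> q fr[of q] by auto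
    moreover have "dist (\<phi> (?x + z \<bullet> v)) (\<phi> ?x) \<le> L * dist (?x + z \<bullet> v) ?x"
      using x zb \<rho> by (intro lipschitz_onD[OF L]) auto
    ultimately have "\<phi> (?x + z \<bullet> v) < ?y + z \<bullet> w"
      using cone[OF z(2)] by (simp add: dist_real_def)
    moreover have "\<bar>?x + z \<bullet> v\<bar> < r" "\<bar>?y + z \<bullet> w\<bar> < h" using x zb \<rho> by auto
    ultimately have "frame_pt p v (?x + z \<bullet> v) (?y + z \<bullet> w) \<in> interior S"
      using S by blast
    then show "u \<in> interior S" using fr[of u] by (simp add: uz)
  qed
  then show ?thesis
    unfolding uniform_interior_cone_at_def using \<rho> \<theta> w by blast
qed

text \<open>A cone of fixed size whose vertex is close to the origin is trapped in the thin region
  \<open>- (x\<^sup>2 / 2) \<le> y \<le> 0\<close>, whose height is quadratically small in the size of the cone.\<close>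

lemma no_uniform_cone:
  assumes \<rho>: "0 < \<rho>"
    and thin: "\<And>x y. (x, y) \<in> interior S \<Longrightarrow> \<bar>x\<bar> < \<rho> \<Longrightarrow> \<bar>y\<bar> < \<rho> \<Longrightarrow> x < 0 \<Longrightarrow> - (x\<^sup>2 / 2) \<le> y \<and> y \<le> 0"
    and axis: "\<And>y. \<bar>y\<bar> < \<rho> \<Longrightarrow> (0, y) \<notin> interior S"
    and acc: "\<And>e. 0 < e \<Longrightarrow> \<exists>q\<in>interior S. norm q < e \<and> fst q < 0"
  shows "\<not> uniform_interior_cone_at S (0, 0)"
proof
  assume "uniform_interior_cone_at S (0, 0)"
  then obtain r h \<theta> where r: "0 < r" and h: "0 < h" and \<theta>: "0 < \<theta>" "\<theta> < pi / 2"
    and cone: "\<And>q. q \<in> interior S \<inter> ball (0, 0) r \<Longrightarrow> \<exists>w. norm w = 1 \<and> open_cone q w \<theta> h \<subseteq> interior S"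
    unfolding uniform_interior_cone_at_def by metis
  define \<alpha> where "\<alpha> = \<theta> / 2"
  have \<alpha>: "0 < sin \<alpha>" "cos \<theta> < cos \<alpha>"
    using \<theta> by (auto simp: \<alpha>_def intro: sin_gt_zero cos_monotone_0_pi)
  have c1: "cos \<theta> < 1" using \<alpha> cos_le_one[of \<alpha>] by linarith
  \<comment> \<open>Besides fitting into the cone and the box, \<open>k\<close> makes the height
    \<open>k\<^sup>2 / 2\<close> of the thin region smaller than \<open>k / 4\<close> and
    \<open>k * sin \<alpha> / 2\<close>. These are the vertical extents of the cone found in the two
    cases below.\<close>
  define k where "k = Min {h, \<rho>, sin \<alpha>, 1/2} / 2"
  have k: "0 < k" "k < h" "k < \<rho>" "k < sin \<alpha>" "k < 1/2"
    using h \<rho> \<alpha> by (auto simp: k_def min_def)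
  obtain q where q: "q \<in> interior S" "norm q < min r (k / 2)" "fst q < 0"
    using acc[of "min r (k / 2)"] r k by auto
  have "q \<in> interior S \<inter> ball (0, 0) r" using q by (simp flip: zero_prod_def)
  then obtain w where w: "norm w = 1" and C: "open_cone q w \<theta> h \<subseteq> interior S"
    using cone by blast
  obtain q1 q2 w1 w2 where qw [simp]: "q = (q1, q2)" "w = (w1, w2)" by (metis surj_pair)
  have w2: "w1\<^sup>2 + w2\<^sup>2 = 1" using w by (simp add: norm_Pair)
  have comp: "\<bar>x\<bar> \<le> norm (x, y)" "\<bar>y\<bar> \<le> norm (x, y)" for x y :: real
    using norm_fst_le[of x y] norm_snd_le[of y x] by auto
  have height: "- (k\<^sup>2 / 2) \<le> y \<and> y \<le> 0" if "(x, y) \<in> interior S" "norm (x, y) < k" "x < 0" for x y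
  proof -
    have "\<bar>x\<bar> < k" "\<bar>y\<bar> < k" using that(2) comp[where x = x and y = y] by linarith+
    moreover from this have "x\<^sup>2 \<le> k\<^sup>2" by (metis abs_of_pos k(1) less_le abs_le_square_iff)
    ultimately show ?thesis using thin[OF that(1)] that(3) k by fastforce
  qed
  have trap: "- (k\<^sup>2 / 2) \<le> q2 + z2 \<and> q2 + z2 \<le> 0"
    if z: "norm (z1, z2) = k / 2" "cos \<theta> * (k / 2) < (z1, z2) \<bullet> w" for z1 z2
  proof -
    have in_int: "(q1 + l * z1, q2 + l * z2) \<in> interior S" if l: "0 < l" "l \<le> 1" for l
    proof -
      have n: "norm (l *\<^sub>R (z1, z2)) = l * (k / 2)" using l by (simp only: norm_scaleR z(1) abs_of_pos)
      have "l * (k / 2) \<le> 1 * (k / 2)" using l k by (intro mult_right_mono) auto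
      then have "norm (l *\<^sub>R (z1, z2)) < h" using k n by linarith
      moreover have "0 < norm (l *\<^sub>R (z1, z2))" unfolding n using l k by simp
      moreover have "cos \<theta> * norm (l *\<^sub>R (z1, z2)) < (l *\<^sub>R (z1, z2)) \<bullet> w"
        unfolding n using mult_strict_left_mono[OF z(2) l(1)] by (simp only: inner_scaleR_left) (simp add: mult_ac)
      ultimately have "q + l *\<^sub>R (z1, z2) \<in> open_cone q w \<theta> h"
        unfolding open_cone_def by blast
      then show ?thesis using C by auto
    qed
    have nb: "norm (q1 + l * z1, q2 + l * z2) < k" if l: "0 < l" "l \<le> 1" for l
    proof -
      have "norm (q + l *\<^sub>R (z1, z2)) \<le> norm q + norm (l *\<^sub>R (z1, z2))" by (rule norm_triangle_ineq)
      also have "norm (l *\<^sub>R (z1, z2)) = l * (k / 2)" using l by (simp only: norm_scaleR z(1) abs_of_pos)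
      also have "l * (k / 2) \<le> 1 * (k / 2)" using l k by (intro mult_right_mono) auto
      finally show ?thesis using q(2) by simp
    qed
    \<comment> \<open>A tip on the other side would force the segment from the vertex through
      \<open>x = 0\<close>, where \<open>axis\<close> excludes interior points.\<close>
    have neg: "q1 + z1 < 0"
    proof (rule ccontr)
      assume "\<not> q1 + z1 < 0"
      then have z1: "0 < z1" "- q1 \<le> z1" using q(3) by auto
      define l where "l = - q1 / z1"
      have l: "0 < l" "l \<le> 1" "q1 + l * z1 = 0"
        using z1 q(3) by (simp_all add: l_def divide_neg_pos pos_le_divide_eq)
      have "\<bar>q2 + l * z2\<bar> < \<rho>" using nb[OF l(1,2)] comp(2)[of "q2 + l * z2" "q1 + l * z1"] k by linarith
      then show False using axis in_int[OF l(1,2)] l(3) by simp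
    qed
    show ?thesis using height[of "q1 + z1" "q2 + z2"] in_int[of 1] nb[of 1] neg by simp
  qed
  have kk: "k * k < k * (1/2)" "k * k < k * sin \<alpha>"
    using k by (auto intro: mult_strict_left_mono)
  show False
  proof (cases "1/2 \<le> \<bar>w2\<bar>")
    \<comment> \<open>For a steep cone axis, the vertex and the point at distance
      \<open>k / 2\<close> along the axis already differ too much in height.\<close>
    case True
    have "(k / 2 * w1, k / 2 * w2) = (k / 2) *\<^sub>R w" by simp
    then have "norm (k / 2 * w1, k / 2 * w2) = k / 2" using w k by (simp del: qw)
    moreover have "(k / 2 * w1, k / 2 * w2) \<bullet> w = k / 2 * (w1\<^sup>2 + w2\<^sup>2)"
      by (simp add: inner_prod_def power2_eq_square algebra_simps)
    then have "cos \<theta> * (k / 2) < (k / 2 * w1, k / 2 * w2) \<bullet> w"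
      using c1 k by (simp add: w2)
    ultimately have "- (k\<^sup>2 / 2) \<le> q2 + k / 2 * w2 \<and> q2 + k / 2 * w2 \<le> 0" by (rule trap)
    moreover have "- (k\<^sup>2 / 2) \<le> q2 \<and> q2 \<le> 0"
      using height[of q1 q2] q k by simp
    ultimately have "\<bar>k / 2 * w2\<bar> \<le> k\<^sup>2 / 2" by linarith
    moreover have "k / 2 * (1/2) \<le> k / 2 * \<bar>w2\<bar>" using True k by (intro mult_left_mono) auto
    then have "k / 2 * (1/2) \<le> \<bar>k / 2 * w2\<bar>" using k by (simp add: abs_mult)
    ultimately show False using kk by (simp add: power2_eq_square)
  next
    case False
    have "1/2 \<le> \<bar>w1\<bar>"
    proof (rule ccontr)
      assume "\<not> 1/2 \<le> \<bar>w1\<bar>"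
      then have "\<bar>w1\<bar>\<^sup>2 < (1/2)\<^sup>2" "\<bar>w2\<bar>\<^sup>2 < (1/2)\<^sup>2"
        using False by (intro power_strict_mono; simp)+
      then show False using w2 by (simp add: power2_eq_square)
    qed
    \<comment> \<open>For a flat cone axis, it is rotated by \<open>\<alpha>\<close> in either
      direction (\<open>e\<close> is the sign). Both directions stay in the cone as
      \<open>cos \<theta> < cos \<alpha>\<close>, and their tips differ in height by
      \<open>k * sin \<alpha> * \<bar>w1\<bar>\<close>.\<close>
    have side: "- (k\<^sup>2 / 2) \<le> q2 + k / 2 * (cos \<alpha> * w2 + e * (sin \<alpha> * w1)) \<and>
        q2 + k / 2 * (cos \<alpha> * w2 + e * (sin \<alpha> * w1)) \<le> 0" if e: "e\<^sup>2 = 1" for e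
    proof (rule trap)
      let ?z1 = "k / 2 * (cos \<alpha> * w1 - e * (sin \<alpha> * w2))"
      let ?z2 = "k / 2 * (cos \<alpha> * w2 + e * (sin \<alpha> * w1))"
      have "?z1\<^sup>2 + ?z2\<^sup>2 = (k / 2)\<^sup>2 * (((cos \<alpha>)\<^sup>2 + e\<^sup>2 * (sin \<alpha>)\<^sup>2) * (w1\<^sup>2 + w2\<^sup>2))"
        by (simp add: power2_eq_square algebra_simps)
      also have "\<dots> = (k / 2)\<^sup>2" by (simp add: e w2)
      finally have "sqrt (?z1\<^sup>2 + ?z2\<^sup>2) = k / 2" using k by simp
      then show "norm (?z1, ?z2) = k / 2" by (simp only: norm_Pair real_norm_def power2_abs)
      have "(?z1, ?z2) \<bullet> w = k / 2 * cos \<alpha> * (w1\<^sup>2 + w2\<^sup>2)"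
        by (simp add: inner_prod_def power2_eq_square algebra_simps)
      then show "cos \<theta> * (k / 2) < (?z1, ?z2) \<bullet> w" using \<alpha> k by (simp add: w2)
    qed
    have "\<bar>k / 2 * (cos \<alpha> * w2 + 1 * (sin \<alpha> * w1)) - k / 2 * (cos \<alpha> * w2 + (- 1) * (sin \<alpha> * w1))\<bar> \<le> k\<^sup>2 / 2"
    proof -
      have "\<bar>A - B\<bar> \<le> K" if "- K \<le> q2 + A \<and> q2 + A \<le> 0" "- K \<le> q2 + B \<and> q2 + B \<le> 0" for A B K
        using that by linarith
      then show ?thesis using side[of 1] side[of "- 1"] by (simp only: power_one power2_minus)
    qed
    moreover have "k / 2 * (cos \<alpha> * w2 + 1 * (sin \<alpha> * w1)) - k / 2 * (cos \<alpha> * w2 + (- 1) * (sin \<alpha> * w1))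
        = k * sin \<alpha> * w1" by (simp add: algebra_simps)
    moreover have "k * sin \<alpha> * (1/2) \<le> k * sin \<alpha> * \<bar>w1\<bar>"
      using \<open>1/2 \<le> \<bar>w1\<bar>\<close> k \<alpha> by (intro mult_left_mono) auto
    then have "k * sin \<alpha> * (1/2) \<le> \<bar>k * sin \<alpha> * w1\<bar>" using k \<alpha> by (simp add: abs_mult)
    ultimately show False using kk by (simp add: power2_eq_square)
  qed
qed

text \<open>Off the graph, continuity of \<open>\<phi>\<close> leaves room inside the box; a point
  on the graph is expelled from the interior by moving slightly down.\<close>

lemma local_epigraph_boundary:
  fixes \<phi> :: "real \<Rightarrow> real"
  assumes \<phi>: "continuous_on UNIV \<phi>"
    and S: "\<And>x y. \<bar>x\<bar> < \<rho> \<Longrightarrow> \<bar>y\<bar> < \<rho> \<Longrightarrow> (x, y) \<in> S \<longleftrightarrow> \<phi> x \<le> y"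
    and xy: "\<bar>x\<bar> < \<rho>" "\<bar>y\<bar> < \<rho>"
  shows "(x, y) \<in> interior S \<longleftrightarrow> \<phi> x < y" "(x, y) \<in> frontier S \<longleftrightarrow> y = \<phi> x"
proof -
  let ?B = "{p :: real \<times> real. \<bar>fst p\<bar> < \<rho>} \<inter> {p :: real \<times> real. \<bar>snd p\<bar> < \<rho>}"
  have c: "continuous_on UNIV (\<lambda>p :: real \<times> real. \<phi> (fst p))"
    by (rule continuous_on_compose2[OF \<phi>]) (auto intro: continuous_intros)
  have B: "open ?B" by (intro open_Int open_Collect_less continuous_intros)
  have above: "(x, y) \<in> interior S" if "\<phi> x < y"
  proof (rule interiorI)
    show "open (?B \<inter> {p :: real \<times> real. \<phi> (fst p) < snd p})"
      by (intro open_Int B open_Collect_less continuous_intros c)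
    show "(x, y) \<in> ?B \<inter> {p :: real \<times> real. \<phi> (fst p) < snd p}" using xy that by simp
    show "?B \<inter> {p :: real \<times> real. \<phi> (fst p) < snd p} \<subseteq> S" using S by auto
  qed
  have below: "(x, y) \<notin> closure S" if "y < \<phi> x"
  proof -
    have "open (?B \<inter> {p :: real \<times> real. snd p < \<phi> (fst p)})"
      by (intro open_Int B open_Collect_less continuous_intros c)
    moreover have "(?B \<inter> {p :: real \<times> real. snd p < \<phi> (fst p)}) \<inter> S = {}" using S by auto
    ultimately have "(?B \<inter> {p :: real \<times> real. snd p < \<phi> (fst p)}) \<inter> closure S = {}"
      by (simp add: open_Int_closure_eq_empty)
    moreover have "(x, y) \<in> ?B \<inter> {p :: real \<times> real. snd p < \<phi> (fst p)}" using xy that by simp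
    ultimately show ?thesis by blast
  qed
  have not_int: "(x, y) \<notin> interior S" if "y = \<phi> x"
  proof
    assume "(x, y) \<in> interior S"
    then obtain d where d: "0 < d" "d < \<rho> - \<bar>y\<bar>" "(x, y - d) \<in> interior S"
      using open_vertical[OF open_interior, of x y S "\<rho> - \<bar>y\<bar>"] xy by auto
    then have "(x, y - d) \<in> S" using interior_subset by blast
    moreover have "\<bar>y - d\<bar> < \<rho>" using d by linarith
    ultimately show False using S[of x "y - d"] xy that d by simp
  qed
  have in_S: "(x, y) \<in> closure S" if "y = \<phi> x"
    using S[OF xy] that closure_subset by auto
  show "(x, y) \<in> interior S \<longleftrightarrow> \<phi> x < y"
    using above below not_int interior_subset closure_subset by (metis linorder_neqE_linordered_idom subsetD)
  show "(x, y) \<in> frontier S \<longleftrightarrow> y = \<phi> x"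
    using above below not_int in_S unfolding frontier_def
    by (metis DiffD1 DiffD2 DiffI linorder_neqE_linordered_idom)
qed

section \<open>The attainable set near the origin\<close>

lemma G_signs:
  assumes t: "0 < t" and G: "(x, y) \<in> G t"
  shows "0 \<le> x \<Longrightarrow> x\<^sup>2 / 2 \<le> y" "x \<le> t" "- t < x \<Longrightarrow> x < 0 \<Longrightarrow> - (x\<^sup>2 / 2) \<le> y"
proof -
  have neg: "- (x\<^sup>2 / 2) \<le> 0" by simp
  consider "(x, y) \<in> closure (G_up t)" | "(x, y) \<in> closure (G_down t)" | "(x, y) \<in> P_plus t"
    | "(x, y) \<in> P_minus t"
    using G by (auto simp: G_eq_closure[OF t])
  then have "(0 \<le> x \<longrightarrow> x\<^sup>2 / 2 \<le> y) \<and> x \<le> t \<and> (- t < x \<longrightarrow> x < 0 \<longrightarrow> - (x\<^sup>2 / 2) \<le> y)"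
  proof cases
    case 1
    then show ?thesis using closure_G_up_signs[OF t 1] neg by linarith
  next
    case 2
    have "x = 0" if "0 \<le> x" using closure_G_down_signs(1)[OF t 2] that by simp
    then show ?thesis using closure_G_down_signs[OF t 2] t by auto
  qed (use t in \<open>auto simp: P_plus_def P_minus_def\<close>)
  then show "0 \<le> x \<Longrightarrow> x\<^sup>2 / 2 \<le> y" "x \<le> t" "- t < x \<Longrightarrow> x < 0 \<Longrightarrow> - (x\<^sup>2 / 2) \<le> y"
    by auto
qed

lemma lower_boundary_G_right:
  assumes t: "0 < t"
  shows "lower_boundary (G t \<inter> {x. fst x \<ge> 0}) = {(x, x\<^sup>2 / 2) | x. 0 \<le> x \<and> x \<le> t}"
proof -
  have in_G: "(x, x\<^sup>2 / 2) \<in> G t" if "0 \<le> x" "x \<le> t" for x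
    using that by (auto simp: G_def P_plus_def)
  show ?thesis
  proof (intro equalityI subsetI)
    fix p assume "p \<in> lower_boundary (G t \<inter> {x. fst x \<ge> 0})"
    then obtain x y where p: "p = (x, y)" and xy: "(x, y) \<in> G t" "0 \<le> x"
      and least: "\<And>y'. (x, y') \<in> G t \<Longrightarrow> y \<le> y'"
      by (auto simp: lower_boundary_def)
    have "x \<le> t" "x\<^sup>2 / 2 \<le> y" using G_signs[OF t xy(1)] xy(2) by auto
    moreover have "y \<le> x\<^sup>2 / 2" using least in_G xy(2) \<open>x \<le> t\<close> by blast
    ultimately show "p \<in> {(x, x\<^sup>2 / 2) | x. 0 \<le> x \<and> x \<le> t}" using p xy(2) by auto
  next
    fix p assume "p \<in> {(x, x\<^sup>2 / 2) | x :: real. 0 \<le> x \<and> x \<le> t}"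
    then show "p \<in> lower_boundary (G t \<inter> {x. fst x \<ge> 0})"
      using in_G G_signs(1)[OF t] by (auto simp: lower_boundary_def)
  qed
qed

text \<open>Strictly between the lower arc and the axis, with \<open>- t < x\<close>, only
  trajectories that have crossed can arrive. For the point obtained by \<open>cross_inv\<close> the
  conditions \<open>0 < b\<close> and \<open>b \<le> threshold t a\<close> follow from the position
  of \<open>(x, y)\<close>, so only membership in the disc remains to be tested.\<close>

lemma G_lower_iff:
  assumes t: "0 < t" and x: "- t < x" "x < 0" and y: "- (x\<^sup>2 / 2) < y" "y < 0"
  shows "(x, y) \<in> G t \<longleftrightarrow> cross_inv t (x, y) \<in> G0"
proof
  assume "(x, y) \<in> G t"
  moreover have "(x, y) \<notin> Phi_plus t ` cap t"
    using closure_G_up_signs(1)[OF t] y closure_G_up[OF t] by force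
  moreover have "(x, y) \<notin> P_plus t" "(x, y) \<notin> P_minus t"
    using x y by (auto simp: P_plus_def P_minus_def)
  ultimately obtain a b where ab: "(a, b) \<in> hypo t" "fall t (a, b) = (x, y)"
    by (auto simp: G_eq[OF t])
  then have "0 < b" using fall_signs(5)[OF t ab] x by simp
  then have "cross_map t (a, b) = (x, y)" using ab by (auto simp: fall_def)
  then have "cross_inv t (x, y) = (a, b)" using cross_inv_cross_map by metis
  then show "cross_inv t (x, y) \<in> G0" using ab by (simp add: hypo_def)
next
  assume in_G0: "cross_inv t (x, y) \<in> G0"
  obtain a b where ab: "cross_inv t (x, y) = (a, b)" by fastforce
  define s where "s = sqrt (x\<^sup>2 + 2 * y)"
  have s: "0 < s" "s\<^sup>2 = x\<^sup>2 + 2 * y" using y by (auto simp: s_def)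
  have "s < sqrt ((- x)\<^sup>2)" unfolding s_def using y by (intro real_sqrt_less_mono) simp
  then have sx: "s < - x" using x by simp
  have a: "a = - x - t - 2 * s" using ab by (simp add: cross_inv_def Let_def s_def)
  have e: "a\<^sup>2 - 2 * b = s\<^sup>2" using cross_inv_energy[OF ab] s by simp
  have "s\<^sup>2 < (- a)\<^sup>2" using a s(1) x by (intro power_strict_mono) auto
  then have b: "0 < b" using e by simp
  have "b \<le> threshold t a"
  proof (cases "- t \<le> a")
    case True
    have "0 \<le> s\<^sup>2" by simp
    then show ?thesis unfolding threshold_right[OF True] using e by linarith
  next
    case False
    have "(- (a + t))\<^sup>2 \<le> s\<^sup>2" using False a sx by (intro power_mono) auto
    then have "(a + t)\<^sup>2 \<le> a\<^sup>2 - 2 * b" unfolding e power2_minus .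
    then show ?thesis using False by (simp add: threshold_left power2_eq_square algebra_simps)
  qed
  then have "(a, b) \<in> hypo t" using in_G0 ab by (simp add: hypo_def)
  moreover have "fall t (a, b) = (x, y)"
    using b cross_map_cross_inv[of t "(x, y)"] ab by (simp add: fall_def)
  ultimately show "(x, y) \<in> G t" unfolding G_eq[OF t] by (metis UnI1 UnI2 imageI)
qed

text \<open>Both \<open>cross_inv t\<close> and \<open>Phi_plus (- t)\<close> send the origin to
  \<open>(- t, t\<^sup>2 / 2)\<close>, which is interior to the disc. By continuity the disc imposes
  no condition nearby, and \<open>G t\<close> is locally shaped by the threshold and the arcs
  alone.\<close>

lemma G_near_origin:
  assumes t: "0 < t" "t < t_star"
  obtains \<rho> where "0 < \<rho>" "\<rho> \<le> t" "\<And>x y. \<bar>x\<bar> < \<rho> \<Longrightarrow> \<bar>y\<bar> < \<rho> \<Longrightarrow> (x, y) \<in> G t \<longleftrightarrow> x * \<bar>x\<bar> / 2 \<le> y"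
proof -
  let ?U = "cross_inv t -` interior G0 \<inter> Phi_plus (- t) -` interior G0"
  have "open ?U"
    by (intro open_Int open_vimage open_interior continuous_on_cross_inv continuous_on_Phi)
  moreover have "cross_inv t (0, 0) = (- t, t\<^sup>2 / 2)" "Phi_plus (- t) (0, 0) = (- t, t\<^sup>2 / 2)"
    by (simp_all add: cross_inv_def Phi_plus_def)
  then have "(0, 0) \<in> ?U" using parabola_in_interior_G0[OF t] by simp
  ultimately obtain e where e: "0 < e" "ball (0, 0) e \<subseteq> ?U" using open_contains_ball by blast
  define \<rho> where "\<rho> = min (e / 2) t"
  have \<rho>: "0 < \<rho>" "\<rho> \<le> t" "\<rho> \<le> e / 2" using e t by (auto simp: \<rho>_def)
  have U: "cross_inv t (x, y) \<in> G0" "Phi_plus (- t) (x, y) \<in> G0" if "\<bar>x\<bar> < \<rho>" "\<bar>y\<bar> < \<rho>" for x y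
  proof -
    have "norm (x, y) \<le> norm x + norm y" by (rule norm_Pair_le)
    also have "\<dots> < e" using that \<rho> by simp
    finally have "(x, y) \<in> ?U" using e(2) by (auto simp flip: zero_prod_def)
    then show "cross_inv t (x, y) \<in> G0" "Phi_plus (- t) (x, y) \<in> G0"
      using interior_subset by auto
  qed
  have up: "(x, y) \<in> G t" if c: "Phi_plus (- t) (x, y) \<in> G0" and "0 \<le> y" "0 \<le> x \<Longrightarrow> x\<^sup>2 / 2 \<le> y" for x y
  proof -
    have P: "Phi_plus (- t) (x, y) = (x - t, y - t * x + t\<^sup>2 / 2)"
      by (simp add: Phi_plus_def)
    have "threshold t (x - t) \<le> y - t * x + t\<^sup>2 / 2"
    proof (cases "0 \<le> x")
      case True
      then show ?thesis using that(3) by (simp add: threshold_right power2_eq_square field_simps)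
    next
      case False
      then show ?thesis using that(2) by (simp add: threshold_left power2_eq_square field_simps)
    qed
    then have "Phi_plus (- t) (x, y) \<in> cap t" using c P by (simp add: cap_def)
    then have "Phi_plus t (Phi_plus (- t) (x, y)) \<in> G t" unfolding G_eq[OF t(1)] by blast
    then show ?thesis by (simp add: Phi_plus_uminus')
  qed
  have "(x, y) \<in> G t \<longleftrightarrow> x * \<bar>x\<bar> / 2 \<le> y" if xy: "\<bar>x\<bar> < \<rho>" "\<bar>y\<bar> < \<rho>" for x y
  proof (cases "0 \<le> x")
    case True
    have "(x, y) \<in> G t \<longleftrightarrow> x\<^sup>2 / 2 \<le> y"
    proof
      assume "x\<^sup>2 / 2 \<le> y"
      moreover have "0 \<le> x\<^sup>2 / 2" by simp
      ultimately show "(x, y) \<in> G t" using up[OF U(2)[OF xy]] by linarith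
    qed (use G_signs(1)[OF t(1)] True in auto)
    then show ?thesis using True by (simp add: power2_eq_square)
  next
    case False
    then have x: "- t < x" "x < 0" using xy \<rho> by auto
    have "(x, y) \<in> G t \<longleftrightarrow> - (x\<^sup>2 / 2) \<le> y"
    proof
      assume y: "- (x\<^sup>2 / 2) \<le> y"
      consider "0 \<le> y" | "- (x\<^sup>2 / 2) < y" "y < 0" | "y = - (x\<^sup>2 / 2)" using y by linarith
      then show "(x, y) \<in> G t"
      proof cases
        case 1
        then show ?thesis using up[OF U(2)[OF xy]] False by simp
      next
        case 2
        then show ?thesis using G_lower_iff[OF t(1) x] U(1)[OF xy] by simp
      next
        case 3
        then have "(x, y) \<in> P_minus t" using x by (auto simp: P_minus_def intro!: exI[of _ "- x"])
        then show ?thesis by (simp add: G_def)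
      qed
    qed (use G_signs(3)[OF t(1)] x in auto)
    then show ?thesis using x by (simp add: power2_eq_square)
  qed
  then show ?thesis using that \<rho> by blast
qed

text \<open>The function \<open>x * \<bar>x\<bar> / 2\<close> is Lipschitz with constant
  \<open>\<rho>\<close> on the box, and \<open>G t\<close> is locally its epigraph. The cusp of the
  lower phase comes from cutting this epigraph along the axis.\<close>

lemma not_cusp_G:
  assumes t: "0 < t" "t < t_star" shows "\<not> cusp_at (G t) (0, 0)"
proof -
  obtain \<rho> where \<rho>: "0 < \<rho>" "\<rho> \<le> t"
    and G: "\<And>x y. \<bar>x\<bar> < \<rho> \<Longrightarrow> \<bar>y\<bar> < \<rho> \<Longrightarrow> (x, y) \<in> G t \<longleftrightarrow> x * \<bar>x\<bar> / 2 \<le> y"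
    using G_near_origin[OF t] by blast
  define \<phi> where "\<phi> x = x * \<bar>x\<bar> / 2" for x :: real
  have c: "continuous_on UNIV \<phi>" unfolding \<phi>_def by (intro continuous_intros) auto
  have loc: "(x, y) \<in> G t \<longleftrightarrow> \<phi> x \<le> y" if "\<bar>x\<bar> < \<rho>" "\<bar>y\<bar> < \<rho>" for x y
    using G that by (simp add: \<phi>_def)
  have lip: "\<rho>-lipschitz_on {-\<rho><..<\<rho>} \<phi>"
  proof (rule lipschitz_onI)
    fix x z assume xz: "x \<in> {-\<rho><..<\<rho>}" "z \<in> {-\<rho><..<\<rho>}"
    have "x * \<bar>x\<bar> - z * \<bar>z\<bar> = (x - z) * \<bar>x\<bar> + z * (\<bar>x\<bar> - \<bar>z\<bar>)"
      by (simp add: algebra_simps)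
    then have "\<bar>x * \<bar>x\<bar> - z * \<bar>z\<bar>\<bar> \<le> \<bar>x - z\<bar> * \<bar>x\<bar> + \<bar>z\<bar> * \<bar>\<bar>x\<bar> - \<bar>z\<bar>\<bar>"
      by (metis abs_abs abs_mult abs_triangle_ineq)
    also have "\<dots> \<le> \<bar>x - z\<bar> * \<rho> + \<rho> * \<bar>x - z\<bar>"
      using xz by (intro add_mono mult_mono abs_triangle_ineq3) auto
    finally show "dist (\<phi> x) (\<phi> z) \<le> \<rho> * dist x z"
      by (simp add: \<phi>_def dist_real_def flip: diff_divide_distrib)
  qed (use \<rho> in simp)
  have "lipschitz_boundary_at (G t) (0, 0)"
    unfolding lipschitz_boundary_at_def
  proof (intro exI conjI)
    show "norm (1::real, 0::real) = 1" by (simp add: norm_Pair)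
    show "0 < \<rho>" "0 < \<rho>" by (fact \<rho>)+
    show "\<rho>-lipschitz_on {-\<rho><..<\<rho>} \<phi>" by (fact lip)
    show "\<forall>x y. \<bar>x\<bar> < \<rho> \<and> \<bar>y\<bar> < \<rho> \<longrightarrow>
        (frame_pt (0, 0) (1, 0) x y \<in> frontier (G t) \<longleftrightarrow> y = \<phi> x) \<and>
        (frame_pt (0, 0) (1, 0) x y \<in> interior (G t) \<longleftrightarrow> \<phi> x < y)"
      using local_epigraph_boundary[OF c loc] by (simp add: frame_pt_eq)
  qed
  then show ?thesis by (simp add: cusp_at_def)
qed

lemma origin_closure_G_down:
  assumes t: "0 < t" "t \<le> t_star" shows "(0, 0) \<in> closure (G_down t)"
proof -
  have "(- t, t\<^sup>2 / 2) \<in> hypo t"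
    using parabola_in_G0[of t] t by (simp add: hypo_def threshold_right)
  moreover have "fall t (- t, t\<^sup>2 / 2) = (0, 0)"
    using t cross_map_parabola[of "- t" t] by (simp add: fall_def)
  ultimately show ?thesis
    unfolding closure_G_down[OF t(1)] by (metis imageI)
qed

lemma G_down_near_origin:
  assumes t: "0 < t" "t \<le> t_star" and e: "0 < e"
  shows "\<exists>q\<in>G_down t. norm q < e \<and> fst q < 0"
proof -
  obtain q where q: "q \<in> G_down t" "dist q (0, 0) < e"
    using origin_closure_G_down[OF t] e closure_approachable by blast
  then show ?thesis
    using G_down_neg(2)[OF t(1), of "fst q" "snd q"] by (auto simp flip: zero_prod_def)
qed

section \<open>Frontier arcs and cusp pieces at the origin\<close>

lemma frontierI_vertical:
  fixes S :: "(real \<times> real) set"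
  assumes "(x, y) \<in> closure S" "0 < c" "\<And>d. 0 < d \<Longrightarrow> d < c \<Longrightarrow> (x, y - d) \<notin> S \<or> (x, y + d) \<notin> S"
  shows "(x, y) \<in> frontier S"
proof -
  have "(x, y) \<notin> interior S"
  proof
    assume "(x, y) \<in> interior S"
    from open_vertical[OF open_interior this assms(2)] show False
      using assms(3) interior_subset by (metis subsetD)
  qed
  then show ?thesis using assms(1) by (simp add: frontier_def)
qed

lemma half_square_over_self: "((\<lambda>x::real. x\<^sup>2 / 2 / x) \<longlongrightarrow> 0) (at_right 0)"
proof -
  have "((\<lambda>x::real. x / 2) \<longlongrightarrow> 0 / 2) (at_right 0)" by (intro tendsto_intros) auto
  moreover have "\<forall>\<^sub>F x::real in at_right 0. x / 2 = x\<^sup>2 / 2 / x"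
    using eventually_at_right_less by eventually_elim (simp add: power2_eq_square)
  ultimately show ?thesis using tendsto_cong by fastforce
qed

text \<open>All pieces at the origin are written over the tangent ray \<open>(- 1, 0)\<close>, so that
  \<open>frame_pt (0, 0) (- 1, 0) x y = (- x, - y)\<close>.\<close>

lemma cusp_piecesI:
  assumes "0 < \<delta>" "continuous_on {0..<\<delta>} f"
    and "\<And>x. 0 < x \<Longrightarrow> x < \<delta> \<Longrightarrow> 0 \<le> f x \<and> f x < x\<^sup>2 / 2" "f 0 = 0"
    and "\<And>x. 0 \<le> x \<Longrightarrow> x < \<delta> \<Longrightarrow> (- x, - f x) \<in> frontier S \<and> (- x, - (x\<^sup>2 / 2)) \<in> frontier S"
    and "\<And>x y. 0 < x \<Longrightarrow> x < \<delta> \<Longrightarrow> f x < y \<Longrightarrow> y < x\<^sup>2 / 2 \<Longrightarrow> (- x, - y) \<in> S"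
  shows "cusp_pieces S (0, 0) (- 1, 0) f (\<lambda>x. x\<^sup>2 / 2) \<delta>"
proof -
  have "((\<lambda>x. f x / x) \<longlongrightarrow> 0) (at_right 0)"
  proof (rule tendsto_sandwich[OF _ _ tendsto_const half_square_over_self])
    have ev: "\<forall>\<^sub>F x in at_right 0. 0 < x \<and> x < \<delta>"
      using eventually_at_right_real[OF assms(1)] by eventually_elim auto
    show "\<forall>\<^sub>F x in at_right 0. 0 \<le> f x / x"
      using ev by eventually_elim (use assms(3) in simp)
    show "\<forall>\<^sub>F x in at_right 0. f x / x \<le> x\<^sup>2 / 2 / x"
      using ev
    proof eventually_elim
      case (elim x)
      then show ?case using assms(3)[of x] by (intro divide_right_mono) auto
    qed
  qed
  then show ?thesis
    unfolding cusp_pieces_def using assms half_square_over_self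
    by (auto simp: frame_pt_eq norm_Pair intro!: continuous_intros)
qed

lemma G_lower_phase_cusp:
  assumes t: "0 < t" "t < t_star"
  shows "cusp_at (G_lower_phase t) (0, 0)"
    and "\<exists>e0>0. \<forall>\<epsilon>. 0 < \<epsilon> \<and> \<epsilon> \<le> e0 \<longrightarrow>
           {(x, 0) | x. - \<epsilon> < x \<and> x < 0} \<subseteq> frontier (G_lower_phase t) \<and>
           {(x, - (x\<^sup>2 / 2)) | x. - \<epsilon> < x \<and> x < 0} \<subseteq> frontier (G_lower_phase t) \<and>
           cusp_pieces (G_lower_phase t) (0, 0) (-1, 0) (\<lambda>_. 0) (\<lambda>s. s\<^sup>2 / 2) \<epsilon>"
proof -
  let ?S = "G_lower_phase t"
  obtain \<rho> where \<rho>: "0 < \<rho>" "\<rho> \<le> t"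
    and G: "\<And>x y. \<bar>x\<bar> < \<rho> \<Longrightarrow> \<bar>y\<bar> < \<rho> \<Longrightarrow> (x, y) \<in> G t \<longleftrightarrow> x * \<bar>x\<bar> / 2 \<le> y"
    using G_near_origin[OF t] by blast
  \<comment> \<open>The bound 1 gives \<open>x\<^sup>2 < e0\<close>, which keeps the whole fibre
    down to the lower arc inside the box of size \<open>\<rho>\<close>.\<close>
  define e0 where "e0 = min \<rho> 1"
  have e0: "0 < e0" "e0 \<le> \<rho>" "e0 \<le> 1" using \<rho> by (auto simp: e0_def)
  have sq: "x\<^sup>2 < e0" if "0 < x" "x < e0" for x
  proof -
    have "x * x \<le> x * 1" using that e0 by (intro mult_left_mono) auto
    then show ?thesis unfolding power2_eq_square using that by linarith
  qed
  have S: "(- x, - y) \<in> ?S \<longleftrightarrow> 0 < y \<and> y \<le> x\<^sup>2 / 2" if "0 < x" "x < e0" for x y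
  proof -
    have "(- x, - y) \<in> ?S" if y: "0 < y" "y \<le> x\<^sup>2 / 2"
    proof -
      have "y < \<rho>" using y sq \<open>0 < x\<close> \<open>x < e0\<close> e0 by fastforce
      then have "(- x, - y) \<in> G t"
        using G[of "- x" "- y"] y \<open>0 < x\<close> \<open>x < e0\<close> e0 by (simp add: power2_eq_square)
      then show ?thesis using y by (simp add: G_lower_phase_def)
    qed
    moreover have "y \<le> x\<^sup>2 / 2" if "(- x, - y) \<in> ?S"
      using that G_signs(3)[OF t(1), of "- x" "- y"] \<open>0 < x\<close> \<open>x < e0\<close> e0 \<rho>
      by (auto simp: G_lower_phase_def)
    ultimately show ?thesis by (auto simp: G_lower_phase_def)
  qed
  have top: "(- x, 0) \<in> frontier ?S" if "0 < x" "x < e0" for x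
  proof (rule frontierI_vertical)
    \<comment> \<open>The axis itself is removed from the lower phase by the strict inequality, so
      its points are reached as limits from below.\<close>
    have "((\<lambda>d. (- x, - d)) \<longlongrightarrow> (- x, - 0 :: real)) (at_right 0)"
      by (rule tendsto_Pair[OF tendsto_const tendsto_minus[OF tendsto_ident_at]])
    moreover have "\<forall>\<^sub>F d in at_right 0. (- x, - d) \<in> ?S"
      using eventually_at_right_real[of 0 "x\<^sup>2 / 2"] that
      by (auto elim!: eventually_mono simp: S)
    ultimately have "(- x, - 0) \<in> closure ?S"
      by (intro Lim_in_closed_set[of "closure ?S" _ "at_right 0"])
        (auto elim!: eventually_mono simp: closure_subset[THEN subsetD])
    then show "(- x, 0) \<in> closure ?S" by simp
  qed (auto simp: G_lower_phase_def intro: zero_less_one)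
  have bottom: "(- x, - (x\<^sup>2 / 2)) \<in> frontier ?S" if "0 < x" "x < e0" for x
  proof (rule frontierI_vertical)
    have "(- x, - (x\<^sup>2 / 2)) \<in> ?S" using S[OF that] that by simp
    then show "(- x, - (x\<^sup>2 / 2)) \<in> closure ?S" using closure_subset by blast
    show "(- x, - (x\<^sup>2 / 2) - d) \<notin> ?S \<or> (- x, - (x\<^sup>2 / 2) + d) \<notin> ?S" if "0 < d" "d < 1" for d
      using S[OF \<open>0 < x\<close> \<open>x < e0\<close>, of "x\<^sup>2 / 2 + d"] that by simp
  qed simp
  have down: "G_down t \<subseteq> ?S"
    using interior_G_between(1)[OF t(1)] interior_subset[of "G t"] G_down_neg(1)[OF t(1)]
    by (auto simp: G_lower_phase_def)
  have "(0, 0) \<in> closure ?S"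
    using origin_closure_G_down[of t] t closure_mono[OF down] by auto
  then have origin: "(0, 0) \<in> frontier ?S"
    by (rule frontierI_vertical[OF _ zero_less_one]) (simp add: G_lower_phase_def)
  have pieces: "cusp_pieces ?S (0, 0) (-1, 0) (\<lambda>_. 0) (\<lambda>s. s\<^sup>2 / 2) \<epsilon>" if "0 < \<epsilon>" "\<epsilon> \<le> e0" for \<epsilon>
  proof (rule cusp_piecesI)
    show "(- x, - 0) \<in> frontier ?S \<and> (- x, - (x\<^sup>2 / 2)) \<in> frontier ?S" if "0 \<le> x" "x < \<epsilon>" for x
      using top[of x] bottom[of x] origin that \<open>\<epsilon> \<le> e0\<close> by (cases "x = 0") auto
    show "(- x, - y) \<in> ?S" if "0 < x" "x < \<epsilon>" "0 < y" "y < x\<^sup>2 / 2" for x y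
      using S[of x y] that \<open>\<epsilon> \<le> e0\<close> by simp
  qed (use that in auto)
  have "{(x, 0) | x. - \<epsilon> < x \<and> x < 0} \<subseteq> frontier ?S \<and>
        {(x, - (x\<^sup>2 / 2)) | x. - \<epsilon> < x \<and> x < 0} \<subseteq> frontier ?S" if "0 < \<epsilon>" "\<epsilon> \<le> e0" for \<epsilon>
    using top[of "- x" for x] bottom[of "- x" for x] that by auto
  then show "\<exists>e0>0. \<forall>\<epsilon>. 0 < \<epsilon> \<and> \<epsilon> \<le> e0 \<longrightarrow>
           {(x, 0) | x. - \<epsilon> < x \<and> x < 0} \<subseteq> frontier (G_lower_phase t) \<and>
           {(x, - (x\<^sup>2 / 2)) | x. - \<epsilon> < x \<and> x < 0} \<subseteq> frontier (G_lower_phase t) \<and>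
           cusp_pieces (G_lower_phase t) (0, 0) (-1, 0) (\<lambda>_. 0) (\<lambda>s. s\<^sup>2 / 2) \<epsilon>"
    using pieces e0(1) by blast
  have "\<not> uniform_interior_cone_at ?S (0, 0)"
  proof (rule no_uniform_cone[OF \<rho>(1)])
    show "- (x\<^sup>2 / 2) \<le> y \<and> y \<le> 0" if "(x, y) \<in> interior ?S" "\<bar>x\<bar> < \<rho>" "\<bar>y\<bar> < \<rho>" "x < 0" for x y
    proof -
      have "(x, y) \<in> ?S" using that interior_subset by blast
      then show ?thesis
        using G_signs(3)[OF t(1), of x y] that \<rho> by (auto simp: G_lower_phase_def)
    qed
    have "(0, y) \<notin> ?S" for y
      using G_signs(1)[OF t(1), of 0 y] by (auto simp: G_lower_phase_def)
    then show "(0, y) \<notin> interior ?S" for y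
      using interior_subset by blast
    have "G_down t \<subseteq> interior ?S" using down open_G_down by (rule interior_maximal)
    then show "\<exists>q\<in>interior ?S. norm q < e \<and> fst q < 0" if "0 < e" for e
      using G_down_near_origin[OF t(1) _ that] t by auto
  qed
  moreover from this have "\<not> lipschitz_boundary_at ?S (0, 0)" using lipschitz_boundary_imp_cone by blast
  ultimately show "cusp_at ?S (0, 0)"
    unfolding cusp_at_def using pieces[OF e0(1)] by blast
qed

section \<open>The cusp at the critical time\<close>

lemma closure_G_up_ge:
  assumes "t_star \<le> t" "(x, y) \<in> closure (G_up t)" shows "t - t_star \<le> x"
proof -
  have t: "0 < t" using assms t_star_bounds by simp
  obtain a b where "(a, b) \<in> cap t" "Phi_plus t (a, b) = (x, y)"
    using assms by (auto simp: closure_G_up[OF t])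
  then show ?thesis using cap_fst_ge[OF assms(1)] by (auto simp: Phi_plus_def)
qed

text \<open>For crossing trajectories \<open>x = - a - t - 2 * s\<close>. If
  \<open>a \<ge> - t_star\<close>, then \<open>s \<ge> 0\<close> suffices; further left the disc is
  too low for \<open>s\<close> to be small.\<close>

lemma closure_G_down_le:
  assumes "t_star \<le> t" "(x, y) \<in> closure (G_down t)" shows "x \<le> - (t - t_star)"
proof -
  have t: "0 < t" using assms t_star_bounds by simp
  obtain a b where ab: "(a, b) \<in> hypo t" "fall t (a, b) = (x, y)"
    using assms by (auto simp: closure_G_down[OF t])
  have a: "a \<le> 0" using ab hypo_fst_le[of t] by auto
  show ?thesis
  proof (cases "b \<le> 0")
    case True
    then show ?thesis using ab a t_star_bounds by (auto simp: fall_def Phi_minus_def)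
  next
    case False
    define s where "s = sqrt (a\<^sup>2 - 2 * b)"
    have x: "x = - a - t - 2 * s" using False ab by (auto simp: fall_def cross_map_def Let_def s_def)
    have nn: "0 \<le> a\<^sup>2 - 2 * b" using ab threshold_le[of t a] by (simp add: hypo_def)
    then have s: "0 \<le> s" by (simp add: s_def)
    show ?thesis
    proof (cases "- t_star \<le> a")
      case False
      have "b < t_star\<^sup>2 / 2" using ab False by (intro G0_height_left) (auto simp: hypo_def)
      \<comment> \<open>From \<open>- a - t_star \<le> 4 * (- a + t_star)\<close>. Together with
        \<open>2 * b < t_star\<^sup>2\<close> it gives
        \<open>2 * s \<ge> - a - t_star\<close>.\<close>
      moreover have "(- a - t_star) * (- a - t_star) \<le> (- a - t_star) * (4 * (- a + t_star))"
        using False t_star_bounds by (intro mult_left_mono) auto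
      then have "(- a - t_star)\<^sup>2 \<le> 4 * (a\<^sup>2 - t_star\<^sup>2)"
        by (simp add: power2_eq_square algebra_simps)
      ultimately have "((- a - t_star) / 2)\<^sup>2 \<le> a\<^sup>2 - 2 * b"
        by (simp only: power_divide) simp
      then have "(- a - t_star) / 2 \<le> s" unfolding s_def by (rule real_le_rsqrt)
      then show ?thesis using x by simp
    qed (use x s in simp)
  qed
qed

text \<open>Only cap points with \<open>a = - t_star\<close> arrive at \<open>x = 0\<close> under
  \<open>Phi_plus t_star\<close>, and the top of the disc there is mapped to the origin. Hence no
  cone near the cusp can pass across \<open>x = 0\<close>.\<close>

lemma G_critical_axis:
  assumes "(0, y) \<in> G t_star" shows "y = 0"
proof -
  have t: "0 < t_star" using t_star_bounds by simp
  have "0 \<le> y" using G_signs(1)[OF t assms] by simp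
  moreover have "y \<le> 0" if "(0, y) \<in> closure (G_up t_star)"
  proof -
    have "(0, y) \<in> Phi_plus t_star ` cap t_star" using that closure_G_up[OF t] by simp
    then obtain a b where ab: "(a, b) \<in> cap t_star" "Phi_plus t_star (a, b) = (0, y)"
      by (metis imageE surj_pair)
    then have a: "a = - t_star" and "y = b + t_star * a + t_star\<^sup>2 / 2"
      by (auto simp: Phi_plus_def)
    then have y: "y = b - t_star\<^sup>2 / 2" by (simp add: power2_eq_square)
    have "b\<^sup>2 \<le> t_star - t_star\<^sup>2"
      using ab by (simp add: cap_def mem_G0 a)
    also have "\<dots> = (t_star\<^sup>2 / 2)\<^sup>2"
      using parabola_poly[of t_star] t_star_root by simp
    finally have "b \<le> t_star\<^sup>2 / 2"
      by (rule power2_le_imp_le) simp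
    then show ?thesis by (simp add: y)
  qed
  moreover have "y \<le> 0" if "(0, y) \<in> closure (G_down t_star)"
    using closure_G_down_signs(2)[OF t that] .
  ultimately show ?thesis
    using assms by (auto simp: G_eq_closure[OF t] P_plus_def P_minus_def)
qed

text \<open>\<open>cross_inv t_star\<close> maps the point \<open>(- \<xi>, (s\<^sup>2 - \<xi>\<^sup>2) / 2)\<close> into the disc iff
  \<open>crit_fun \<xi> s \<le> 0\<close>.\<close>

definition crit_fun :: "real \<Rightarrow> real \<Rightarrow> real" where
  "crit_fun \<xi> s = (\<xi> - t_star - 2 * s)\<^sup>2 + (\<xi> - t_star - 2 * s)
     + (((\<xi> - t_star - 2 * s)\<^sup>2 - s\<^sup>2) / 2)\<^sup>2"

lemma cross_inv_crit:
  assumes "0 \<le> s"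
  shows "cross_inv t_star (- \<xi>, (s\<^sup>2 - \<xi>\<^sup>2) / 2) \<in> G0 \<longleftrightarrow> crit_fun \<xi> s \<le> 0"
proof -
  have e: "(- \<xi>)\<^sup>2 + 2 * ((s\<^sup>2 - \<xi>\<^sup>2) / 2) = s\<^sup>2"
    by (simp add: field_simps)
  moreover have "sqrt ((- \<xi>)\<^sup>2 + 2 * ((s\<^sup>2 - \<xi>\<^sup>2) / 2)) = s"
    unfolding e using assms by simp
  ultimately have "cross_inv t_star (- \<xi>, (s\<^sup>2 - \<xi>\<^sup>2) / 2) =
      (- (- \<xi>) - t_star - 2 * s, ((- \<xi> + t_star + 2 * s)\<^sup>2 - s\<^sup>2) / 2)"
    unfolding cross_inv_def Let_def by (simp only: prod.case)
  also have "(- \<xi> + t_star + 2 * s)\<^sup>2 = (\<xi> - t_star - 2 * s)\<^sup>2"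
    by (simp add: power2_eq_square algebra_simps)
  finally show ?thesis by (simp add: mem_G0 crit_fun_def)
qed

text \<open>With \<open>m = t_star - \<xi> + 2 * s\<close> the function is
  \<open>m * (m - 1)\<close> plus the square of \<open>(m - s) * (m + s) / 2\<close>. The second
  part increases because both factors are positive and increase; the first increases because
  \<open>m \<ge> 1/2\<close>, which is where the bound on \<open>\<xi>\<close> comes from.\<close>

lemma crit_fun_strict_mono:
  assumes "\<xi> \<le> t_star - 1/2" "0 \<le> s" "s < s'"
  shows "crit_fun \<xi> s < crit_fun \<xi> s'"
proof -
  define m where "m = t_star - \<xi> + 2 * s"
  define m' where "m' = t_star - \<xi> + 2 * s'"
  have m: "1/2 \<le> m" "m < m'" "0 < m - s" "m - s < m' - s'" "0 < m + s" "m + s < m' + s'"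
    using assms by (auto simp: m_def m'_def)
  have eq: "crit_fun \<xi> s = m * (m - 1) + ((m - s) * (m + s) / 2)\<^sup>2"
    "crit_fun \<xi> s' = m' * (m' - 1) + ((m' - s') * (m' + s') / 2)\<^sup>2"
    by (simp_all add: crit_fun_def m_def m'_def power2_eq_square algebra_simps)
  have "0 < (m' - m) * (m' + m - 1)" using m by (intro mult_pos_pos) auto
  then have 1: "m * (m - 1) < m' * (m' - 1)" by (simp add: algebra_simps)
  have "(m - s) * (m + s) < (m' - s') * (m' + s')"
    using m by (intro mult_strict_mono) auto
  moreover have "0 < (m - s) * (m + s)" using m by simp
  ultimately have "((m - s) * (m + s) / 2)\<^sup>2 < ((m' - s') * (m' + s') / 2)\<^sup>2"
    by (intro power_strict_mono) auto
  then show ?thesis using 1 eq by simp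
qed

text \<open>The value \<open>s = 0\<close> belongs to the lower arc, whose points are pulled back to
  the parabola inside the disc.\<close>

lemma crit_fun_left:
  assumes "0 < \<xi>" "\<xi> < t_star" shows "crit_fun \<xi> 0 < 0"
  using parabola_in_interior_G0[of "t_star - \<xi>"] assms
  by (simp add: interior_G0_iff crit_fun_def power2_commute[of \<xi> t_star])

text \<open>The value \<open>s = \<xi>\<close> belongs to the axis. Its points are pulled back to
  the left of \<open>- t_star\<close> at height \<open>t_star\<^sup>2 / 2 + \<xi> * t_star\<close>,
  too high for the disc.\<close>

lemma crit_fun_right:
  assumes "0 < \<xi>" shows "0 < crit_fun \<xi> \<xi>"
proof (rule ccontr)
  assume "\<not> 0 < crit_fun \<xi> \<xi>"
  then have "(\<xi> - t_star - 2 * \<xi>, ((\<xi> - t_star - 2 * \<xi>)\<^sup>2 - \<xi>\<^sup>2) / 2) \<in> G0"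
    by (simp add: mem_G0 crit_fun_def)
  then have "((\<xi> - t_star - 2 * \<xi>)\<^sup>2 - \<xi>\<^sup>2) / 2 < t_star\<^sup>2 / 2"
    using assms by (intro G0_height_left) auto
  moreover have "0 < \<xi> * t_star" using assms t_star_bounds by simp
  ultimately show False by (simp add: power2_eq_square algebra_simps)
qed

lemma crit_fun_zero: "crit_fun 0 0 = 0"
  using parabola_poly[of t_star] t_star_root by (simp add: crit_fun_def)

text \<open>The intermediate value theorem gives the root and monotonicity its uniqueness.
  Continuity, including at 0, follows from the closed graph and the compact range, without
  differentiating \<open>crit_fun\<close>.\<close>

lemma crit_root:
  obtains S where "continuous_on {0..t_star - 1/2} S"
    "\<And>\<xi>. \<xi> \<in> {0..t_star - 1/2} \<Longrightarrow> 0 \<le> S \<xi> \<and> S \<xi> \<le> \<xi> \<and> crit_fun \<xi> (S \<xi>) = 0"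
proof -
  let ?I = "{0..t_star - 1/2}"
  have ex: "\<exists>s. 0 \<le> s \<and> s \<le> \<xi> \<and> crit_fun \<xi> s = 0" if "\<xi> \<in> ?I" for \<xi>
  proof (cases "\<xi> = 0")
    case True
    then show ?thesis using crit_fun_zero by auto
  next
    case False
    have "continuous_on {0..\<xi>} (crit_fun \<xi>)"
      unfolding crit_fun_def by (intro continuous_intros) auto
    then show ?thesis
      using IVT'[of "crit_fun \<xi>" 0 0 \<xi>] crit_fun_left[of \<xi>] crit_fun_right[of \<xi>] that False
        t_star_bounds by auto
  qed
  then obtain S where S: "\<And>\<xi>. \<xi> \<in> ?I \<Longrightarrow> 0 \<le> S \<xi> \<and> S \<xi> \<le> \<xi> \<and> crit_fun \<xi> (S \<xi>) = 0"
    by metis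
  have "continuous_on ?I S"
  proof (rule continuous_from_closed_graph)
    show "compact ?I" by simp
    show "S \<in> ?I \<rightarrow> ?I" using S by fastforce
    have "(\<lambda>\<xi>. (\<xi>, S \<xi>)) ` ?I = (?I \<times> UNIV) \<inter> {p. 0 \<le> snd p} \<inter> {p. snd p \<le> fst p} \<inter>
        {p. crit_fun (fst p) (snd p) = 0}" (is "_ = ?C")
    proof (intro equalityI subsetI)
      fix p assume "p \<in> ?C"
      then obtain \<xi> s where p: "p = (\<xi>, s)" "\<xi> \<in> ?I" "0 \<le> s" "crit_fun \<xi> s = 0"
        by (cases p) auto
      then have "s = S \<xi>"
        using S[of \<xi>] crit_fun_strict_mono[of \<xi> s "S \<xi>"] crit_fun_strict_mono[of \<xi> "S \<xi>" s]
        by (cases s "S \<xi>" rule: linorder_cases) auto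
      then show "p \<in> (\<lambda>\<xi>. (\<xi>, S \<xi>)) ` ?I" using p by blast
    qed (use S in auto)
    moreover have "closed ?C"
      unfolding crit_fun_def
      by (intro closed_Int closed_Times closed_Collect_le closed_Collect_eq continuous_intros) auto
    ultimately show "closed ((\<lambda>\<xi>. (\<xi>, S \<xi>)) ` ?I)" by simp
  qed
  then show ?thesis using that S by blast
qed

text \<open>The upper piece is part of the image of the circle, given implicitly through
  \<open>S\<close>. Tangency requires no expansion of it: being squeezed between the axis and the
  lower arc is enough.\<close>

lemma G_critical_cusp: "cusp_at (G t_star) (0, 0)"
proof -
  let ?S = "G t_star"
  have t: "0 < t_star" using t_star_bounds by simp
  have clos: "closure ?S = ?S" using compact_G[OF t] by (simp add: compact_imp_closed)
  obtain S where cS: "continuous_on {0..t_star - 1/2} S"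
    and S: "\<And>\<xi>. \<xi> \<in> {0..t_star - 1/2} \<Longrightarrow> 0 \<le> S \<xi> \<and> S \<xi> \<le> \<xi> \<and> crit_fun \<xi> (S \<xi>) = 0"
    using crit_root by blast
  define \<delta> where "\<delta> = t_star - 1/2"
  have \<delta>: "0 < \<delta>" "\<delta> < t_star" using t_star_bounds by (auto simp: \<delta>_def)
  define f where "f \<xi> = (\<xi>\<^sup>2 - (S \<xi>)\<^sup>2) / 2" for \<xi>
  have S': "0 < S \<xi>" "S \<xi> < \<xi>" "crit_fun \<xi> (S \<xi>) = 0" if "0 < \<xi>" "\<xi> < \<delta>" for \<xi>
  proof -
    have *: "0 \<le> S \<xi> \<and> S \<xi> \<le> \<xi> \<and> crit_fun \<xi> (S \<xi>) = 0" using S[of \<xi>] that by (simp add: \<delta>_def)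
    moreover have "crit_fun \<xi> 0 < 0" using crit_fun_left[of \<xi>] that \<delta> by simp
    moreover have "0 < crit_fun \<xi> \<xi>" using crit_fun_right that by simp
    ultimately show "0 < S \<xi>" "S \<xi> < \<xi>" "crit_fun \<xi> (S \<xi>) = 0"
      by (auto simp: less_le)
  qed
  have S0: "S 0 = 0" using S[of 0] t_star_bounds by auto
  have fb: "0 < f \<xi> \<and> f \<xi> < \<xi>\<^sup>2 / 2" if "0 < \<xi>" "\<xi> < \<delta>" for \<xi>
  proof -
    have "(S \<xi>)\<^sup>2 < \<xi>\<^sup>2" "0 < (S \<xi>)\<^sup>2" using S'[OF that] by (auto intro: power_strict_mono)
    then show ?thesis by (simp add: f_def)
  qed
  have memb: "(- \<xi>, - y) \<in> ?S \<longleftrightarrow> f \<xi> \<le> y" if \<xi>: "0 < \<xi>" "\<xi> < \<delta>" and y: "0 < y" "y < \<xi>\<^sup>2 / 2" for \<xi> y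
  proof -
    define s where "s = sqrt (\<xi>\<^sup>2 - 2 * y)"
    have s: "0 < s" "s\<^sup>2 = \<xi>\<^sup>2 - 2 * y" using y by (auto simp: s_def)
    have yq: "- y = (s\<^sup>2 - \<xi>\<^sup>2) / 2" using s by simp
    have "(- \<xi>, - y) \<in> ?S \<longleftrightarrow> cross_inv t_star (- \<xi>, - y) \<in> G0"
      using \<xi> y \<delta> by (intro G_lower_iff t) auto
    also have "\<dots> \<longleftrightarrow> crit_fun \<xi> s \<le> 0"
      unfolding yq using s by (intro cross_inv_crit) auto
    also have "\<dots> \<longleftrightarrow> s \<le> S \<xi>"
      using crit_fun_strict_mono[of \<xi> s "S \<xi>"] crit_fun_strict_mono[of \<xi> "S \<xi>" s] S'[OF \<xi>] s \<xi>
      by (cases s "S \<xi>" rule: linorder_cases) (auto simp: \<delta>_def)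
    also have "\<dots> \<longleftrightarrow> s\<^sup>2 \<le> (S \<xi>)\<^sup>2"
      using power_mono_iff[of s "S \<xi>" 2] s(1) S'[OF \<xi>] by simp
    also have "\<dots> \<longleftrightarrow> f \<xi> \<le> y" by (auto simp: f_def s(2) field_simps)
    finally show ?thesis .
  qed
  have top: "(- \<xi>, - f \<xi>) \<in> frontier ?S" if \<xi>: "0 < \<xi>" "\<xi> < \<delta>" for \<xi>
  proof (rule frontierI_vertical)
    show "(- \<xi>, - f \<xi>) \<in> closure ?S" unfolding clos using memb[OF \<xi>] fb[OF \<xi>] by simp
    show "0 < f \<xi>" using fb[OF \<xi>] by simp
    show "(- \<xi>, - f \<xi> - d) \<notin> ?S \<or> (- \<xi>, - f \<xi> + d) \<notin> ?S" if "0 < d" "d < f \<xi>" for d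
      using memb[OF \<xi>, of "f \<xi> - d"] fb[OF \<xi>] that by simp
  qed
  have bottom: "(- \<xi>, - (\<xi>\<^sup>2 / 2)) \<in> frontier ?S" if \<xi>: "0 \<le> \<xi>" "\<xi> < \<delta>" for \<xi>
  proof (rule frontierI_vertical)
    have "(- \<xi>, - (\<xi>\<^sup>2 / 2)) \<in> P_minus t_star" using \<xi> \<delta> by (auto simp: P_minus_def)
    then show "(- \<xi>, - (\<xi>\<^sup>2 / 2)) \<in> closure ?S" unfolding clos by (simp add: G_def)
    show "(- \<xi>, - (\<xi>\<^sup>2 / 2) - d) \<notin> ?S \<or> (- \<xi>, - (\<xi>\<^sup>2 / 2) + d) \<notin> ?S" if "0 < d" "d < 1" for d
      using G_signs(1,3)[OF t, of "- \<xi>" "- (\<xi>\<^sup>2 / 2) - d"] \<xi> \<delta> that by (cases "\<xi> = 0") auto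
  qed simp
  have pieces: "cusp_pieces ?S (0, 0) (- 1, 0) f (\<lambda>x. x\<^sup>2 / 2) \<delta>"
  proof (rule cusp_piecesI)
    show "continuous_on {0..<\<delta>} f"
      unfolding f_def by (intro continuous_intros continuous_on_subset[OF cS]) (auto simp: \<delta>_def)
    show "0 \<le> f x \<and> f x < x\<^sup>2 / 2" if "0 < x" "x < \<delta>" for x using fb[OF that] by simp
    show f0: "f 0 = 0" by (simp add: f_def S0)
    show "(- x, - f x) \<in> frontier ?S \<and> (- x, - (x\<^sup>2 / 2)) \<in> frontier ?S" if "0 \<le> x" "x < \<delta>" for x
      using top[of x] bottom[of x] f0 that by (cases "x = 0") auto
    show "(- x, - y) \<in> ?S" if "0 < x" "x < \<delta>" "f x < y" "y < x\<^sup>2 / 2" for x y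
      using memb[of x y] fb[of x] that by simp
  qed (rule \<delta>)
  have "\<not> uniform_interior_cone_at ?S (0, 0)"
  proof (rule no_uniform_cone[OF t])
    show "- (x\<^sup>2 / 2) \<le> y \<and> y \<le> 0" if "(x, y) \<in> interior ?S" "\<bar>x\<bar> < t_star" "\<bar>y\<bar> < t_star" "x < 0" for x y
    proof -
      have xy: "(x, y) \<in> ?S" using that interior_subset by blast
      have "y \<le> 0"
      proof -
        have "(x, y) \<notin> closure (G_up t_star)"
          using closure_G_up_ge[of t_star x y] that by auto
        then show ?thesis
          using xy closure_G_down_signs(2)[OF t, of x y] that
          by (auto simp: G_eq_closure[OF t] P_plus_def P_minus_def)
      qed
      then show ?thesis using G_signs(3)[OF t xy] that by auto
    qed
    show "(0, y) \<notin> interior ?S" for y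
    proof
      assume y: "(0, y) \<in> interior ?S"
      obtain d where "0 < d" "(0, y + d) \<in> interior ?S"
        using open_vertical[OF open_interior y zero_less_one] by blast
      then have "y + d = 0" "y = 0"
        using y interior_subset[of ?S] G_critical_axis by blast+
      then show False using \<open>0 < d\<close> by simp
    qed
    show "\<exists>q\<in>interior ?S. norm q < e \<and> fst q < 0" if "0 < e" for e
      using G_down_near_origin[OF t _ that] interior_G_between(1)[OF t] by auto
  qed
  moreover from this have "\<not> lipschitz_boundary_at ?S (0, 0)" using lipschitz_boundary_imp_cone by blast
  ultimately show ?thesis
    unfolding cusp_at_def using pieces by blast
qed

section \<open>Connected components\<close>

text \<open>A ball around an interior point on the axis just left of the origin joins the two
  pieces: its upper half can only be covered by the closure of \<open>G_up t\<close>, its lower half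
  only by that of \<open>G_down t\<close>.\<close>

lemma connected_interior_G:
  assumes t: "0 < t" "t < t_star"
  shows "connected (interior (G t))" "connected (G t)"
proof -
  obtain \<rho> where \<rho>: "0 < \<rho>" "\<rho> \<le> t"
    and G: "\<And>x y. \<bar>x\<bar> < \<rho> \<Longrightarrow> \<bar>y\<bar> < \<rho> \<Longrightarrow> (x, y) \<in> G t \<longleftrightarrow> x * \<bar>x\<bar> / 2 \<le> y"
    using G_near_origin[OF t] by blast
  define \<phi> where "\<phi> x = x * \<bar>x\<bar> / 2" for x :: real
  have c: "continuous_on UNIV \<phi>" unfolding \<phi>_def by (intro continuous_intros) auto
  define x0 where "x0 = - (\<rho> / 2)"
  have "(x0, 0) \<in> interior (G t)"
    using local_epigraph_boundary(1)[OF c, of \<rho> "G t" x0 0] G \<rho>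
    by (simp add: \<phi>_def x0_def)
  then obtain e where e: "0 < e" "ball (x0, 0) e \<subseteq> interior (G t)"
    using open_contains_ball open_interior by blast
  let ?B = "ball (x0, 0 :: real) e"
  have half: "(x0, d) \<in> ?B" if "\<bar>d\<bar> < e" for d
    using that by (simp add: dist_Pair_Pair dist_real_def)
  have meets: "?B \<inter> U \<noteq> {}" if "(x0, d) \<in> closure U" "\<bar>d\<bar> < e" for d U
    using open_Int_closure_eq_empty[of ?B U] half[OF that(2)] that(1) by blast
  have in_cl: "(x0, d) \<in> closure (G_up t) \<union> closure (G_down t)" if "\<bar>d\<bar> < e" for d
    using half[OF that] e(2) interior_G_between(2)[OF t(1)] by blast
  have "(x0, e / 2) \<in> closure (G_up t)"
    using in_cl[of "e / 2"] closure_G_down_signs(2)[OF t(1), of x0 "e / 2"] e by auto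
  then have up: "?B \<inter> G_up t \<noteq> {}" using meets e by simp
  have "(x0, - (e / 2)) \<in> closure (G_down t)"
    using in_cl[of "- (e / 2)"] closure_G_up_signs(1)[OF t(1), of x0 "- (e / 2)"] e by auto
  then have down: "?B \<inter> G_down t \<noteq> {}" using meets e by simp
  let ?A = "(?B \<union> G_up t) \<union> G_down t"
  have A: "connected ?A"
    using up down
    by (intro connected_Un connected_G_up connected_G_down t(1) convex_connected convex_ball) blast+
  have sub: "?A \<subseteq> interior (G t)"
    using interior_G_between(1)[OF t(1)] e(2) by blast
  have cl: "closure (G_up t) \<subseteq> closure ?A" "closure (G_down t) \<subseteq> closure ?A"
    by (intro closure_mono; blast)+
  show "connected (interior (G t))"
    using A sub by (rule connected_intermediate_closure) (use interior_G_between(2)[OF t(1)] cl in blast)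
  have "closure ?A \<subseteq> G t"
    using sub interior_subset[of "G t"] compact_G[OF t(1)]
    by (intro closure_minimal compact_imp_closed) auto
  then have Geq: "G t = (closure ?A \<union> P_plus t) \<union> P_minus t"
    using cl unfolding G_eq_closure[OF t(1)] by blast
  have "(0, 0) \<in> closure ?A" using origin_closure_G_down[of t] t cl by auto
  moreover have "(0, 0) \<in> P_plus t" "(0, 0) \<in> P_minus t"
    using t by (auto simp: P_plus_def P_minus_def)
  ultimately show "connected (G t)"
    unfolding Geq by (intro connected_Un connected_P connected_imp_connected_closure A) blast+
qed

lemma G_components_before:
  assumes t: "0 < t" "t < t_star"
  shows "components (interior (G t)) = {interior (G t)}" "components (G t) = {G t}"
    "interior (G t) \<noteq> {}"
proof -
  show ne: "interior (G t) \<noteq> {}"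
    using interior_G_between(1)[OF t(1)] G_up_nonempty[OF t(1)] by blast
  then have "G t \<noteq> {}" using interior_subset by blast
  then show "components (interior (G t)) = {interior (G t)}" "components (G t) = {G t}"
    using connected_interior_G[OF t] ne by (simp_all add: components_eq_sing_iff)
qed

text \<open>Cut out of the interior instead of being set to \<open>G_up t\<close>, because the
  sandwich leaves open whether \<open>G_up t\<close> exhausts its side of the interior.\<close>

definition G_right :: "real \<Rightarrow> (real \<times> real) set" where
  "G_right t = interior (G t) \<inter> {p. 0 < fst p}"

definition G_left :: "real \<Rightarrow> (real \<times> real) set" where
  "G_left t = interior (G t) \<inter> {p. fst p < 0}"

lemma G_after_halves:
  assumes t: "t_star < t"
  shows "G_up t \<subseteq> G_right t" "G_right t \<subseteq> closure (G_up t)"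
    and "G_down t \<subseteq> G_left t" "G_left t \<subseteq> closure (G_down t)"
    and "G_right t \<union> G_left t = interior (G t)"
proof -
  have t0: "0 < t" using t t_star_bounds by simp
  have ge: "0 < x" if "(x, y) \<in> closure (G_up t)" for x y
    using closure_G_up_ge[OF less_imp_le[OF t] that] t by simp
  have le: "x < 0" if "(x, y) \<in> closure (G_down t)" for x y
    using closure_G_down_le[OF less_imp_le[OF t] that] t by simp
  note between = interior_G_between[OF t0]
  show "G_up t \<subseteq> G_right t" "G_down t \<subseteq> G_left t"
    using between(1) ge le closure_subset by (force simp: G_right_def G_left_def)+
  show "G_right t \<subseteq> closure (G_up t)" "G_left t \<subseteq> closure (G_down t)"
    using between(2) ge le by (force simp: G_right_def G_left_def)+
  show "G_right t \<union> G_left t = interior (G t)"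
    using between(2) ge le by (force simp: G_right_def G_left_def)
qed

lemma closure_G_after:
  assumes t: "t_star < t"
  shows "closure (G_right t) = closure (G_up t)" "closure (G_left t) = closure (G_down t)"
  using closure_mono[OF G_after_halves(1)[OF t]] closure_mono[OF G_after_halves(2)[OF t]]
    closure_mono[OF G_after_halves(3)[OF t]] closure_mono[OF G_after_halves(4)[OF t]]
  by auto

text \<open>Each half lies between a connected set and its closure, hence is connected; two disjoint
  nonempty open connected sets covering the interior are its components.\<close>

lemma G_components_after:
  assumes t: "t_star < t"
  shows "components (interior (G t)) = {G_right t, G_left t}"
    and "G_right t \<noteq> {}" "G_left t \<noteq> {}" "G_right t \<inter> G_left t = {}" "open (G_right t)"
proof -
  have t0: "0 < t" using t t_star_bounds by simp
  show ne: "G_right t \<noteq> {}" "G_left t \<noteq> {}"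
    using G_after_halves(1,3)[OF t] G_up_nonempty[OF t0] G_down_nonempty[OF t0] by blast+
  show disj: "G_right t \<inter> G_left t = {}" by (auto simp: G_right_def G_left_def)
  show opR: "open (G_right t)"
    unfolding G_right_def by (intro open_Int open_interior open_Collect_less continuous_intros)
  have opL: "open (G_left t)"
    unfolding G_left_def by (intro open_Int open_interior open_Collect_less continuous_intros)
  have "connected (G_right t)"
    by (rule connected_intermediate_closure[OF connected_G_up G_after_halves(1,2)[OF t]])
  moreover have "connected (G_left t)"
    by (rule connected_intermediate_closure[OF connected_G_down[OF t0] G_after_halves(3,4)[OF t]])
  ultimately show "components (interior (G t)) = {G_right t, G_left t}"
    using ne disj opR opL G_after_halves(5)[OF t]
    by (intro components_open_unique) (auto simp: pairwise_insert disjnt_def)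
qed

text \<open>The arc points with parameter \<open>r \<ge> t - t_star\<close> come from the parabola
  points \<open>(r - t, (r - t)\<^sup>2 / 2)\<close>, which lie in the disc and in both closed
  pieces. The rest of the arcs is the connector.\<close>

lemma G_after_eq:
  assumes t: "t_star < t"
  shows "G t = closure (G_right t) \<union> closure (G_left t) \<union> (P_plus (t - t_star) \<union> P_minus (t - t_star))"
proof -
  have t0: "0 < t" using t t_star_bounds by simp
  have par: "(r - t, (r - t)\<^sup>2 / 2) \<in> cap t \<inter> hypo t" if "t - t_star \<le> r" "r \<le> t" for r
    using parabola_in_G0[of "t - r"] that t t_star_bounds
    by (simp add: cap_def hypo_def threshold_right power2_commute[of r t])
  have up: "(r, r\<^sup>2 / 2) \<in> closure (G_up t)" if "t - t_star \<le> r" "r \<le> t" for r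
  proof -
    have "Phi_plus t (r - t, (r - t)\<^sup>2 / 2) = (r, r\<^sup>2 / 2)" by (simp add: Phi_plus_parabola)
    then show ?thesis unfolding closure_G_up[OF t0] using par[OF that] by (metis IntD1 imageI)
  qed
  have down: "(- r, - (r\<^sup>2 / 2)) \<in> closure (G_down t)" if "t - t_star \<le> r" "r \<le> t" for r
  proof -
    \<comment> \<open>At \<open>r = t\<close> the starting point is the origin, where
      \<open>fall\<close> takes the branch \<open>Phi_minus\<close>; \<open>cross_map_axis\<close>
      covers this endpoint.\<close>
    have "fall t (r - t, (r - t)\<^sup>2 / 2) = (- r, - (r\<^sup>2 / 2))"
      using cross_map_parabola[of "r - t" t] cross_map_axis[of 0 t] that by (auto simp: fall_def)
    then show ?thesis unfolding closure_G_down[OF t0] using par[OF that] by (metis IntD2 imageI)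
  qed
  have "P_plus t \<subseteq> closure (G_up t) \<union> P_plus (t - t_star)"
  proof
    fix p assume "p \<in> P_plus t"
    then obtain r where r: "p = (r, r\<^sup>2 / 2)" "0 \<le> r" "r \<le> t" by (auto simp: P_plus_def)
    then show "p \<in> closure (G_up t) \<union> P_plus (t - t_star)"
      using up[of r] by (cases "t - t_star \<le> r") (auto simp: P_plus_def)
  qed
  moreover have "P_minus t \<subseteq> closure (G_down t) \<union> P_minus (t - t_star)"
  proof
    fix p assume "p \<in> P_minus t"
    then obtain r where r: "p = (- r, - (r\<^sup>2 / 2))" "0 \<le> r" "r \<le> t" by (auto simp: P_minus_def)
    then show "p \<in> closure (G_down t) \<union> P_minus (t - t_star)"
      using down[of r] by (cases "t - t_star \<le> r") (auto simp: P_minus_def)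
  qed
  moreover have "P_plus (t - t_star) \<subseteq> P_plus t" "P_minus (t - t_star) \<subseteq> P_minus t"
    using t_star_bounds by (auto simp: P_plus_def P_minus_def)
  ultimately show ?thesis
    unfolding closure_G_after[OF t] G_eq_closure[OF t0] by blast
qed

lemma G_right_boundary:
  assumes t: "t_star < t"
  shows "frontier (G_right t) \<inter> P_plus t = {(r, r\<^sup>2 / 2) | r. t - t_star \<le> r \<and> r \<le> t}"
    and "lower_boundary (closure (G_right t)) = {(r, r\<^sup>2 / 2) | r. t - t_star \<le> r \<and> r \<le> t}"
proof -
  have t0: "0 < t" using t t_star_bounds by simp
  have arc: "(r, r\<^sup>2 / 2) \<in> closure (G_right t)" if "t - t_star \<le> r" "r \<le> t" for r
  proof -
    have "(r - t, (r - t)\<^sup>2 / 2) \<in> cap t"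
      using parabola_in_G0[of "t - r"] that t t_star_bounds
      by (simp add: cap_def threshold_right power2_commute[of r t])
    moreover have "Phi_plus t (r - t, (r - t)\<^sup>2 / 2) = (r, r\<^sup>2 / 2)" by (simp add: Phi_plus_parabola)
    ultimately show ?thesis
      unfolding closure_G_after[OF t] closure_G_up[OF t0] by (metis imageI)
  qed
  have bd: "t - t_star \<le> x \<and> x \<le> t \<and> x\<^sup>2 / 2 \<le> y" if "(x, y) \<in> closure (G_right t)" for x y
    using that closure_G_up_signs(2,3)[OF t0, of x y] closure_G_up_ge[OF less_imp_le[OF t], of x y] t
    unfolding closure_G_after[OF t] by auto
  have notin: "(x, x\<^sup>2 / 2) \<notin> G_right t" for x
  proof
    assume x: "(x, x\<^sup>2 / 2) \<in> G_right t"
    obtain d where "0 < d" "(x, x\<^sup>2 / 2 - d) \<in> G_right t"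
      using open_vertical[OF G_components_after(5)[OF t] x zero_less_one] by blast
    then show False using bd[of x "x\<^sup>2 / 2 - d"] closure_subset by auto
  qed
  show "frontier (G_right t) \<inter> P_plus t = {(r, r\<^sup>2 / 2) | r. t - t_star \<le> r \<and> r \<le> t}"
    using arc bd notin t
    by (auto simp: frontier_def interior_open[OF G_components_after(5)[OF t]] P_plus_def)
  show "lower_boundary (closure (G_right t)) = {(r, r\<^sup>2 / 2) | r. t - t_star \<le> r \<and> r \<le> t}"
  proof (intro equalityI subsetI)
    fix p assume "p \<in> lower_boundary (closure (G_right t))"
    then obtain x y where p: "p = (x, y)" and xy: "(x, y) \<in> closure (G_right t)"
      and least: "\<And>y'. (x, y') \<in> closure (G_right t) \<Longrightarrow> y \<le> y'"
      by (auto simp: lower_boundary_def)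
    have "y \<le> x\<^sup>2 / 2" using least arc bd[OF xy] by blast
    then show "p \<in> {(r, r\<^sup>2 / 2) | r. t - t_star \<le> r \<and> r \<le> t}" using p bd[OF xy] by auto
  next
    fix p assume "p \<in> {(r, r\<^sup>2 / 2) | r. t - t_star \<le> r \<and> r \<le> t}"
    then show "p \<in> lower_boundary (closure (G_right t))"
      using arc bd by (auto simp: lower_boundary_def)
  qed
qed

text \<open>That the cusp develops at \<open>t_star\<close> is rendered by its presence then and its
  absence from \<open>G t\<close> at all earlier positive times.\<close>

theorem theoremB1:
  shows
    "(\<forall>t. 0 < t \<and> t < t_star \<longrightarrow>
        (\<exists>!C. C \<in> components (G t) \<and> interior C \<noteq> {}) \<and>
        (\<exists>!C. C \<in> components (interior (G t)))) \<and>
     (\<forall>t. 0 < t \<and> t \<le> t_star \<longrightarrow>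
        lower_boundary (G t \<inter> {x. fst x \<ge> 0}) = {(x, x\<^sup>2 / 2) | x. 0 \<le> x \<and> x \<le> t}) \<and>
     (\<forall>t. t_star < t \<longrightarrow>
        (\<exists>C. {C' \<in> components (interior (G t)). C' \<subseteq> {x. fst x > 0}} = {C} \<and>
             frontier C \<inter> P_plus t = {(r, r\<^sup>2 / 2) | r. t - t_star \<le> r \<and> r \<le> t} \<and>
             lower_boundary (closure C) = {(r, r\<^sup>2 / 2) | r. t - t_star \<le> r \<and> r \<le> t})) \<and>
     (\<forall>t. 0 < t \<and> t < t_star \<longrightarrow>
        cusp_at (G_lower_phase t) (0, 0) \<and>
        (\<exists>e0>0. \<forall>\<epsilon>. 0 < \<epsilon> \<and> \<epsilon> \<le> e0 \<longrightarrow>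
           {(x, 0) | x. - \<epsilon> < x \<and> x < 0} \<subseteq> frontier (G_lower_phase t) \<and>
           {(x, - (x\<^sup>2 / 2)) | x. - \<epsilon> < x \<and> x < 0} \<subseteq> frontier (G_lower_phase t) \<and>
           cusp_pieces (G_lower_phase t) (0, 0) (-1, 0) (\<lambda>_. 0) (\<lambda>s. s\<^sup>2 / 2) \<epsilon>)) \<and>
     (cusp_at (G t_star) (0, 0) \<and>
      (\<forall>t. 0 < t \<and> t < t_star \<longrightarrow> \<not> cusp_at (G t) (0, 0))) \<and>
     (\<forall>t. t_star < t \<longrightarrow>
        (\<exists>Gp Gm. components (interior (G t)) = {Gp, Gm} \<and> Gp \<noteq> Gm \<and>
           Gp \<subseteq> {x. fst x > 0} \<and> Gm \<subseteq> {x. fst x < 0} \<and>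
           G t = closure Gp \<union> closure Gm \<union> (P_plus (t - t_star) \<union> P_minus (t - t_star)))) \<and>
     (\<forall>s t. 0 \<le> s \<and> 0 \<le> t \<longrightarrow>
        emeasure lebesgue (interior (G s)) = emeasure lebesgue (interior (G t)))"
proof (intro conjI allI impI)
  fix t assume t: "0 < t \<and> t < t_star"
  then show "\<exists>!C. C \<in> components (G t) \<and> interior C \<noteq> {}" "\<exists>!C. C \<in> components (interior (G t))"
    using G_components_before[of t] by auto
next
  fix t assume "0 < t \<and> t \<le> t_star"
  then show "lower_boundary (G t \<inter> {x. fst x \<ge> 0}) = {(x, x\<^sup>2 / 2) | x. 0 \<le> x \<and> x \<le> t}"
    by (intro lower_boundary_G_right) simp
next
  fix t assume t: "t_star < t"
  have "G_right t \<subseteq> {x. fst x > 0}" by (auto simp: G_right_def)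
  moreover have "\<not> G_left t \<subseteq> {x. fst x > 0}"
    using G_components_after(3)[OF t] by (auto simp: G_left_def)
  ultimately have "{C' \<in> components (interior (G t)). C' \<subseteq> {x. fst x > 0}} = {G_right t}"
    unfolding G_components_after(1)[OF t] by blast
  then show "\<exists>C. {C' \<in> components (interior (G t)). C' \<subseteq> {x. fst x > 0}} = {C} \<and>
             frontier C \<inter> P_plus t = {(r, r\<^sup>2 / 2) | r. t - t_star \<le> r \<and> r \<le> t} \<and>
             lower_boundary (closure C) = {(r, r\<^sup>2 / 2) | r. t - t_star \<le> r \<and> r \<le> t}"
    using G_right_boundary[OF t] by blast
next
  fix t assume t: "0 < t \<and> t < t_star"
  then show "cusp_at (G_lower_phase t) (0, 0)"
    by (intro G_lower_phase_cusp(1)) auto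
  show "\<exists>e0>0. \<forall>\<epsilon>. 0 < \<epsilon> \<and> \<epsilon> \<le> e0 \<longrightarrow>
           {(x, 0) | x. - \<epsilon> < x \<and> x < 0} \<subseteq> frontier (G_lower_phase t) \<and>
           {(x, - (x\<^sup>2 / 2)) | x. - \<epsilon> < x \<and> x < 0} \<subseteq> frontier (G_lower_phase t) \<and>
           cusp_pieces (G_lower_phase t) (0, 0) (-1, 0) (\<lambda>_. 0) (\<lambda>s. s\<^sup>2 / 2) \<epsilon>"
    using G_lower_phase_cusp(2) t by blast
next
  show "cusp_at (G t_star) (0, 0)" by (rule G_critical_cusp)
next
  fix t assume "0 < t \<and> t < t_star"
  then show "\<not> cusp_at (G t) (0, 0)" using not_cusp_G by blast
next
  fix t assume t: "t_star < t"
  have "G_right t \<noteq> G_left t" using G_components_after(2,4)[OF t] by auto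
  moreover have "G_right t \<subseteq> {x. fst x > 0}" "G_left t \<subseteq> {x. fst x < 0}"
    by (auto simp: G_right_def G_left_def)
  ultimately show "\<exists>Gp Gm. components (interior (G t)) = {Gp, Gm} \<and> Gp \<noteq> Gm \<and>
           Gp \<subseteq> {x. fst x > 0} \<and> Gm \<subseteq> {x. fst x < 0} \<and>
           G t = closure Gp \<union> closure Gm \<union> (P_plus (t - t_star) \<union> P_minus (t - t_star))"
    using G_components_after(1)[OF t] G_after_eq[OF t] by blast
next
  fix s t :: real assume "0 \<le> s \<and> 0 \<le> t"
  then show "emeasure lebesgue (interior (G s)) = emeasure lebesgue (interior (G t))"
    by (metis emeasure_interior_G)
qed

end
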